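(* For each $n\ge1$, the estimating function $$\overline{\mathbf{g}}_n(\beta)=\sum_{i=1}^n\mathbf{X}_i^T\mathbf{A}_i(\beta)^{1/2}\,\overline{\mathbf{R}}_i^{(c)}(\beta)^{-1}\mathbf{A}_i(\beta)^{-1/2}(\mathbf{y}_i-\mu_i(\beta)),\qquad \beta\in\mathcal{T},$$ is optimal (a quasi-score) within the class $\mathcal{H}_n$; that is, for any $\mathbf{q}_n\in\mathcal{H}_n$ and any $\beta\in\mathcal{T}$, the matrix $\mathcal{E}[\overline{\mathbf{g}}_n(\beta)]-\mathcal{E}[\mathbf{q}_n(\beta)]$ is nonnegative definite.
   Context: Model. $m,p\ge1$ are fixed integers, $\mathcal{T}\subset\mathbb{R}^p$ is open, and $\mathbf{y}_i=(y_{i1},\dots,y_{im})^T$, $i\ge1$, are random vectors on a measurable space $(\Omega,\mathcal{F})$ carrying a family of probability measures $\{P_\beta:\beta\in\mathcal{T}\}$. $\mathcal{F}_i$ is the $\sigma$-field generated by $\mathbf{y}_1,\dots,\mathbf{y}_i$ ($\mathcal{F}_0$ trivial). $E_\beta,\mathrm{Var}_\beta,\mathrm{Cov}_\beta$ refer to $P_\beta$. The covariates $\mathbf{x}_{ij}\in\mathbb{R}^p$ are non-random, $\mathbf{X}_i=(\mathbf{x}_{i1},\dots,\mathbf{x}_{im})^T$ ($m\times p$). The link $\mu:\mathbb{R}\to\mathbb{R}$ is differentiable with positive derivative. For all $\beta\in\mathcal{T}$, $i\ge1$, $1\le j\le m$: $$E_\beta(y_{ij}\mid\mathcal{F}_{i-1})=\mu(\mathbf{x}_{ij}^T\beta)=:\mu_{ij}(\beta),\qquad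 \mathrm{Var}_\beta(y_{ij}\mid\mathcal{F}_{i-1})=\mu'(\mathbf{x}_{ij}^T\beta)=:\sigma_{ij}^2(\beta).$$ Put $\mu_i(\beta)=(\mu_{i1}(\beta),\dots,\mu_{im}(\beta))^T$, $\mathbf{A}_i(\beta)=\mathrm{diag}(\sigma^2_{i1}(\beta),\dots,\sigma^2_{im}(\beta))$. The conditional covariance matrix is $\Sigma_i^{(c)}(\beta)=E_\beta[(\mathbf{y}_i-\mu_i(\beta))(\mathbf{y}_i-\mu_i(\beta))^T\mid\mathcal{F}_{i-1}]$, with entries $v^{(c)}_{i,jk}(\beta)$, and the conditional correlation matrix is $\overline{\mathbf{R}}_i^{(c)}(\beta)=\mathbf{A}_i(\beta)^{-1/2}\Sigma_i^{(c)}(\beta)\mathbf{A}_i(\beta)^{-1/2}$, assumed nonsingular. Class of estimating functions. $\mathcal{H}_n$ is the set of functions $\mathbf{q}_n(\beta)=\sum_{i=1}^n\mathbf{C}_i(\beta)(\mathbf{y}_i-\mu_i(\beta))$, $\beta\in\mathcal{T}$, where each $\mathbf{C}_i(\beta)$ is a $p\times m$ random matrix whose entries $c_{i,uj}(\beta)$ are $\mathcal{F}_{i-1}$-measurable and continuously differentiable in $\beta$, and for all $\beta\in\mathcal{T}$, $i\ge1$, $1\le u,v\le p$, $1\le j,k\le m$ the expectations $E_\beta|c_{i,uj}(\beta)|$, $E_\beta\big[\frac{\partial c_{i,uj}(\beta)}{\partial\beta_v}(y_{ij}-\mu_{ij}(\beta))\big]$, $E_\beta[c_{i,uj}(\beta)v^{(c)}_{i,jk}(\beta)c_{i,vk}(\beta)]$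 exist and are finite. The function $\overline{\mathbf{g}}_n$ is assumed to be an element of $\mathcal{H}_n$. For $\mathbf{q}_n\in\mathcal{H}_n$, $$\mathcal{E}[\mathbf{q}_n(\beta)]=\Big\{E_\beta\Big[\frac{\partial\mathbf{q}_n(\beta)}{\partial\beta^T}\Big]\Big\}^T\{\mathrm{Cov}_\beta[\mathbf{q}_n(\beta)]\}^{-1}E_\beta\Big[\frac{\partial\mathbf{q}_n(\beta)}{\partial\beta^T}\Big];$$ it is understood that the covariance matrices $\mathrm{Cov}_\beta[\overline{\mathbf{g}}_n(\beta)]$ and $\mathrm{Cov}_\beta[\mathbf{q}_n(\beta)]$ of the functions being compared are nonsingular, so that these expressions are defined. *)

theory Defs
  imports "HOL-Probability.Probability"
begin

text \<open>
  The dimensions \<open>m\<close> and \<open>p\<close> are the finite index types \<open>'m\<close> and \<open>'p\<close>. Throughout,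
  \<open>M\<close> is the underlying measurable space (its measure is irrelevant), \<open>P \<beta>\<close> the probability
  measure with parameter \<open>\<beta>\<close>, \<open>y i \<omega>\<close> the i-th response vector and \<open>X i\<close> the \<open>m\<times>p\<close> covariate
  matrix, so that \<open>X i $ j\<close> is the covariate vector \<open>x\<^sub>i\<^sub>j\<close>. The index \<open>i\<close> runs through
  \<open>{1, 2, ...}\<close>; values at \<open>i = 0\<close> are never used.
\<close>

definition hist :: "'w measure \<Rightarrow> (nat \<Rightarrow> 'w \<Rightarrow> real^'m) \<Rightarrow> nat \<Rightarrow> 'w measure" where
  "hist M y i = sigma (space M) {y k -` B \<inter> space M | k B. k \<in> {1..i} \<and> B \<in> sets borel}"

definition real_cond_var :: "'w measure \<Rightarrow> 'w measure \<Rightarrow> ('w \<Rightarrow> real) \<Rightarrow> 'w \<Rightarrow> real" where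
  "real_cond_var N F Z = real_cond_exp N F (\<lambda>\<omega>. (Z \<omega> - real_cond_exp N F Z \<omega>)\<^sup>2)"

definition mean_vec :: "(real \<Rightarrow> real) \<Rightarrow> real^'p^'m \<Rightarrow> real^'p \<Rightarrow> real^'m" where
  "mean_vec \<mu> Xi \<beta> = (\<chi> j. \<mu> (Xi $ j \<bullet> \<beta>))"

definition var_vec :: "(real \<Rightarrow> real) \<Rightarrow> real^'p^'m \<Rightarrow> real^'p \<Rightarrow> real^'m" where
  "var_vec \<mu> Xi \<beta> = (\<chi> j. deriv \<mu> (Xi $ j \<bullet> \<beta>))"

definition diag_mat :: "real^'m \<Rightarrow> real^'m^'m" where
  "diag_mat d = (\<chi> j k. if j = k then d $ j else 0)"

text \<open>The matrices \<open>A\<^sub>i(\<beta>)\<^bsup>1/2\<^esup>\<close> and \<open>A\<^sub>i(\<beta>)\<^bsup>-1/2\<^esup>\<close>, where \<open>A\<^sub>i(\<beta>) = diag_mat (var_vec \<mu> (X i) \<beta>)\<close>.\<close>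

definition sqrt_A :: "(real \<Rightarrow> real) \<Rightarrow> real^'p^'m \<Rightarrow> real^'p \<Rightarrow> real^'m^'m" where
  "sqrt_A \<mu> Xi \<beta> = diag_mat (\<chi> j. sqrt (var_vec \<mu> Xi \<beta> $ j))"

definition inv_sqrt_A :: "(real \<Rightarrow> real) \<Rightarrow> real^'p^'m \<Rightarrow> real^'p \<Rightarrow> real^'m^'m" where
  "inv_sqrt_A \<mu> Xi \<beta> = diag_mat (\<chi> j. 1 / sqrt (var_vec \<mu> Xi \<beta> $ j))"

text \<open>
  A conditional covariance matrix is determined only up to null sets. As smoothness in \<open>\<beta>\<close> is
  imposed below for each single \<open>\<omega>\<close>, the choice of the version matters, and we let \<open>S \<beta>\<close> be an
  arbitrary \<open>F\<close>-measurable version of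
  \<open>E\<^sub>\<beta>[(Z - \<mu>(\<beta>)) (Z - \<mu>(\<beta>))\<^sup>T | F]\<close>.
\<close>

definition is_cond_cov ::
  "'w measure \<Rightarrow> 'w measure \<Rightarrow> ('w \<Rightarrow> real^'m) \<Rightarrow> real^'m \<Rightarrow> ('w \<Rightarrow> real^'m^'m) \<Rightarrow> bool" where
  "is_cond_cov N F Z mean S \<longleftrightarrow>
     (\<forall>j k. (\<lambda>\<omega>. S \<omega> $ j $ k) \<in> borel_measurable F \<and>
        (AE \<omega> in N. S \<omega> $ j $ k =
           real_cond_exp N F (\<lambda>\<omega>. (Z \<omega> $ j - mean $ j) * (Z \<omega> $ k - mean $ k)) \<omega>))"

definition cond_corr :: "(real \<Rightarrow> real) \<Rightarrow> real^'p^'m \<Rightarrow> real^'p \<Rightarrow> real^'m^'m \<Rightarrow> real^'m^'m" where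
  "cond_corr \<mu> Xi \<beta> S = inv_sqrt_A \<mu> Xi \<beta> ** S ** inv_sqrt_A \<mu> Xi \<beta>"

definition partial_deriv :: "'p \<Rightarrow> (real^'p \<Rightarrow> real) \<Rightarrow> real^'p \<Rightarrow> real" where
  "partial_deriv v f \<beta> = frechet_derivative f (at \<beta>) (axis v 1)"

definition cont_diff_on :: "(real^'p) set \<Rightarrow> (real^'p \<Rightarrow> real) \<Rightarrow> bool" where
  "cont_diff_on T f \<longleftrightarrow>
     (\<forall>\<beta>\<in>T. f differentiable (at \<beta>)) \<and> (\<forall>v. continuous_on T (partial_deriv v f))"

definition admissible_coeff ::
  "'w measure \<Rightarrow> (real^'p \<Rightarrow> 'w measure) \<Rightarrow> (real^'p) set \<Rightarrow> 'w measure \<Rightarrow> (real \<Rightarrow> real) \<Rightarrow>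
   real^'p^'m \<Rightarrow> ('w \<Rightarrow> real^'m) \<Rightarrow> (real^'p \<Rightarrow> 'w \<Rightarrow> real^'m^'m) \<Rightarrow>
   (real^'p \<Rightarrow> 'w \<Rightarrow> real^'m^'p) \<Rightarrow> bool" where
  "admissible_coeff M P T F \<mu> Xi yi Sig C \<longleftrightarrow>
     (\<forall>u j. \<forall>\<beta>\<in>T. (\<lambda>\<omega>. C \<beta> \<omega> $ u $ j) \<in> borel_measurable F) \<and>
     (\<forall>u j. \<forall>\<omega>\<in>space M. cont_diff_on T (\<lambda>\<beta>. C \<beta> \<omega> $ u $ j)) \<and>
     (\<forall>\<beta>\<in>T. \<forall>u v j k.
        integrable (P \<beta>) (\<lambda>\<omega>. \<bar>C \<beta> \<omega> $ u $ j\<bar>) \<and>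
        integrable (P \<beta>) (\<lambda>\<omega>. partial_deriv v (\<lambda>b. C b \<omega> $ u $ j) \<beta> *
                                (yi \<omega> $ j - mean_vec \<mu> Xi \<beta> $ j)) \<and>
        integrable (P \<beta>) (\<lambda>\<omega>. C \<beta> \<omega> $ u $ j * Sig \<beta> \<omega> $ j $ k * C \<beta> \<omega> $ v $ k))"

text \<open>The class \<open>\<H>\<^sub>n\<close>; an estimating function is a function of \<open>\<beta>\<close> and \<open>\<omega>\<close>.\<close>

definition est_class ::
  "'w measure \<Rightarrow> (real^'p \<Rightarrow> 'w measure) \<Rightarrow> (real^'p) set \<Rightarrow> (real \<Rightarrow> real) \<Rightarrow>
   (nat \<Rightarrow> real^'p^'m) \<Rightarrow> (nat \<Rightarrow> 'w \<Rightarrow> real^'m) \<Rightarrow> (nat \<Rightarrow> real^'p \<Rightarrow> 'w \<Rightarrow> real^'m^'m) \<Rightarrow> nat \<Rightarrow>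
   (real^'p \<Rightarrow> 'w \<Rightarrow> real^'p) set" where
  "est_class M P T \<mu> X y S n =
     {q. \<exists>C. (\<forall>i\<in>{1..n}. admissible_coeff M P T (hist M y (i - 1)) \<mu> (X i) (y i) (S i) (C i)) \<and>
             (\<forall>\<beta>\<in>T. \<forall>\<omega>\<in>space M.
                q \<beta> \<omega> = (\<Sum>i\<in>{1..n}. C i \<beta> \<omega> *v (y i \<omega> - mean_vec \<mu> (X i) \<beta>)))}"

definition gbar ::
  "(real \<Rightarrow> real) \<Rightarrow> (nat \<Rightarrow> real^'p^'m) \<Rightarrow> (nat \<Rightarrow> 'w \<Rightarrow> real^'m) \<Rightarrow>
   (nat \<Rightarrow> real^'p \<Rightarrow> 'w \<Rightarrow> real^'m^'m) \<Rightarrow> nat \<Rightarrow> real^'p \<Rightarrow> 'w \<Rightarrow> real^'p" where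
  "gbar \<mu> X y S n \<beta> \<omega> =
     (\<Sum>i\<in>{1..n}.
        (transpose (X i) ** sqrt_A \<mu> (X i) \<beta> ** matrix_inv (cond_corr \<mu> (X i) \<beta> (S i \<beta> \<omega>))
           ** inv_sqrt_A \<mu> (X i) \<beta>) *v (y i \<omega> - mean_vec \<mu> (X i) \<beta>))"

definition cov_mat :: "'w measure \<Rightarrow> ('w \<Rightarrow> real^'p) \<Rightarrow> real^'p^'p" where
  "cov_mat N Z = (\<chi> u v. integral\<^sup>L N (\<lambda>\<omega>.
      (Z \<omega> $ u - integral\<^sup>L N (\<lambda>\<omega>. Z \<omega> $ u)) * (Z \<omega> $ v - integral\<^sup>L N (\<lambda>\<omega>. Z \<omega> $ v))))"

text \<open>The entry \<open>(u, v)\<close> is the expectation of the partial derivative of \<open>q\<^sub>u\<close> with respect to \<open>\<beta>\<^sub>v\<close>.\<close>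

definition mean_jacobian ::
  "'w measure \<Rightarrow> (real^'p \<Rightarrow> 'w \<Rightarrow> real^'p) \<Rightarrow> real^'p \<Rightarrow> real^'p^'p" where
  "mean_jacobian N q \<beta> = (\<chi> u v. integral\<^sup>L N (\<lambda>\<omega>. jacobian (\<lambda>b. q b \<omega>) (at \<beta>) $ u $ v))"

definition info_mat ::
  "(real^'p \<Rightarrow> 'w measure) \<Rightarrow> (real^'p \<Rightarrow> 'w \<Rightarrow> real^'p) \<Rightarrow> real^'p \<Rightarrow> real^'p^'p" where
  "info_mat P q \<beta> =
     transpose (mean_jacobian (P \<beta>) q \<beta>) ** matrix_inv (cov_mat (P \<beta>) (q \<beta>))
       ** mean_jacobian (P \<beta>) q \<beta>"

definition nonneg_definite :: "real^'p^'p \<Rightarrow> bool" where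
  "nonneg_definite A \<longleftrightarrow> transpose A = A \<and> (\<forall>w. 0 \<le> w \<bullet> (A *v w))"

end

theory Submission
  imports Defs
begin

text \<open>
  The residuals \<open>e\<^sub>i = y\<^sub>i - \<mu>\<^sub>i(\<beta>)\<close> are martingale differences, so for \<open>q = \<Sum> C\<^sub>i e\<^sub>i\<close> and
  \<open>g = \<Sum> G\<^sub>i e\<^sub>i\<close> in the class the cross terms vanish and \<open>E[q g\<^sup>T] = \<Sum> E[C\<^sub>i \<Sigma>\<^sub>i G\<^sub>i\<^sup>T]\<close>. The
  coefficients of the quasi-score satisfy \<open>G\<^sub>i \<Sigma>\<^sub>i = X\<^sub>i\<^sup>T A\<^sub>i\<close>, which turns this into
  \<open>\<Sum> E[C\<^sub>i] A\<^sub>i X\<^sub>i = - E[\<partial>q/\<partial>\<beta>\<^sup>T]\<close>. Thus the information of \<open>g\<close> is \<open>Cov g\<close>, that of \<open>q\<close> is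
  \<open>Cov(g,q) (Cov q)\<^bsup>-1\<^esup> Cov(q,g)\<close>, and the difference is a Schur complement of the covariance
  matrix of \<open>(g, q)\<close>.

  Membership of \<open>g\<close> in the class only provides some admissible coefficients. They agree almost surely
  with the explicit ones, because predictable coefficients of a martingale transform with nonsingular
  conditional covariances are unique.
\<close>

section \<open>Martingale transforms\<close>

lemma (in prob_space) integrable_bounded_mult:
  fixes f g :: "'a \<Rightarrow> real"
  assumes "f \<in> borel_measurable M" and "\<And>x. x \<in> space M \<Longrightarrow> \<bar>f x\<bar> \<le> B" and g: "integrable M g"
  shows "integrable M (\<lambda>x. f x * g x)"
proof (rule Bochner_Integration.integrable_bound)
  show "integrable M (\<lambda>x. B * g x)" using g by simp
  show "(\<lambda>x. f x * g x) \<in> borel_measurable M" using assms by measurable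
  show "AE x in M. norm (f x * g x) \<le> norm (B * g x)"
  proof (rule AE_I2)
    fix x assume "x \<in> space M"
    then have "\<bar>f x\<bar> \<le> \<bar>B\<bar>" using assms(2)[of x] by linarith
    then show "norm (f x * g x) \<le> norm (B * g x)" by (simp add: abs_mult mult_right_mono)
  qed
qed

lemma integrable_product_of_squares:
  fixes f g :: "'a \<Rightarrow> real"
  assumes [measurable]: "f \<in> borel_measurable M" "g \<in> borel_measurable M"
    and "integrable M (\<lambda>x. (f x)\<^sup>2)" "integrable M (\<lambda>x. (g x)\<^sup>2)"
  shows "integrable M (\<lambda>x. f x * g x)"
proof (rule Bochner_Integration.integrable_bound)
  show "integrable M (\<lambda>x. (f x)\<^sup>2 + (g x)\<^sup>2)" using assms by simp
  show "AE x in M. norm (f x * g x) \<le> norm ((f x)\<^sup>2 + (g x)\<^sup>2)"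
  proof (rule AE_I2)
    fix x
    have "2 * (\<bar>f x\<bar> * \<bar>g x\<bar>) \<le> (f x)\<^sup>2 + (g x)\<^sup>2"
      using sum_squares_bound[of "\<bar>f x\<bar>" "\<bar>g x\<bar>"] by simp
    moreover have "0 \<le> \<bar>f x\<bar> * \<bar>g x\<bar>" by simp
    ultimately have "\<bar>f x\<bar> * \<bar>g x\<bar> \<le> (f x)\<^sup>2 + (g x)\<^sup>2" by linarith
    then show "norm (f x * g x) \<le> norm ((f x)\<^sup>2 + (g x)\<^sup>2)" by (simp add: abs_mult)
  qed
qed measurable

text \<open>For nonnegative functions the defining identity of the conditional expectation needs no
  integrability, so finiteness passes from \<open>f * E[g | F]\<close> back to \<open>f * g\<close>.
  In this way a moment condition stated with the conditional covariance controls the products of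
  coefficients and residuals themselves.\<close>

lemma (in sigma_finite_subalgebra) integrable_mult_of_real_cond_exp:
  assumes [measurable]: "f \<in> borel_measurable F"
    and f: "\<And>x. 0 \<le> f x" and g: "\<And>x. 0 \<le> g x" and gi: "integrable M g"
    and fg: "integrable M (\<lambda>x. f x * real_cond_exp M F g x)"
  shows "integrable M (\<lambda>x. f x * g x)"
proof (rule integrableI_bounded)
  have [measurable]: "f \<in> borel_measurable M" by (rule measurable_from_subalg[OF subalg assms(1)])
  have [measurable]: "g \<in> borel_measurable M" using gi by simp
  show "(\<lambda>x. f x * g x) \<in> borel_measurable M" by measurable
  let ?h = "nn_cond_exp M F (\<lambda>x. ennreal (g x))"
  have "(\<integral>\<^sup>+x. ?h x \<partial>M) = (\<integral>\<^sup>+x. ennreal (g x) \<partial>M)"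
    using nn_cond_exp_intg[of "\<lambda>_. 1" "\<lambda>x. ennreal (g x)"] by simp
  also have "\<dots> < \<infinity>" using gi g by (simp add: integrable_iff_bounded)
  finally have fin: "AE x in M. ?h x \<noteq> \<infinity>"
    by (intro nn_integral_noteq_infinite) auto
  have zero: "AE x in M. nn_cond_exp M F (\<lambda>x. ennreal (- g x)) x = 0"
  proof -
    have "(\<lambda>x. ennreal (- g x)) = (\<lambda>_. 0)" using g by (auto simp: ennreal_neg)
    then show ?thesis using nn_cond_exp_F_meas[of "\<lambda>_. 0"] by auto
  qed
  \<comment> \<open>\<open>real_cond_exp\<close> is a difference of two nonnegative conditional
    expectations pushed through \<open>enn2real\<close>. The second one vanishes because
    \<open>g\<close> is nonnegative, and finiteness of \<open>?h\<close> keeps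
    \<open>enn2real\<close> from sending infinity to 0.\<close>
  have eq: "AE x in M. ?h x = ennreal (real_cond_exp M F g x)"
    using fin zero by eventually_elim (auto simp: real_cond_exp_def less_top)
  have "(\<integral>\<^sup>+x. ennreal (norm (f x * g x)) \<partial>M) = (\<integral>\<^sup>+x. ennreal (f x) * ennreal (g x) \<partial>M)"
    by (simp add: f g abs_mult ennreal_mult)
  also have "\<dots> = (\<integral>\<^sup>+x. ennreal (f x) * ?h x \<partial>M)"
    by (rule nn_cond_exp_intg[symmetric]) measurable
  also have "\<dots> = (\<integral>\<^sup>+x. ennreal (f x * real_cond_exp M F g x) \<partial>M)"
    by (rule nn_integral_cong_AE) (use eq in eventually_elim, simp add: f ennreal_mult')
  also have "\<dots> \<le> (\<integral>\<^sup>+x. ennreal (norm (f x * real_cond_exp M F g x)) \<partial>M)"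
    by (intro nn_integral_mono ennreal_leI) simp
  also have "\<dots> < \<infinity>" using fg by (simp add: integrable_iff_bounded)
  finally show "(\<integral>\<^sup>+x. ennreal (norm (f x * g x)) \<partial>M) < \<infinity>" .
qed

text \<open>The parameter is frozen here: \<open>F\<close>, \<open>e\<close> and \<open>S\<close>
  stand for the histories, the residuals and the conditional covariances at a single value of
  \<beta>, so that only one measure occurs. The bounds \<open>i \<ge> 1\<close> keep
  \<open>F (i - 1)\<close> clear of truncated subtraction at 0.\<close>

locale martingale_differences = prob_space N
  for N :: "'w measure" +
  fixes F :: "nat \<Rightarrow> 'w measure" and e :: "nat \<Rightarrow> 'w \<Rightarrow> real^'m" and S :: "nat \<Rightarrow> 'w \<Rightarrow> real^'m^'m"
  assumes subalg: "subalgebra N (F i)"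
    and mono: "i \<le> l \<Longrightarrow> sets (F i) \<subseteq> sets (F l)"
    and meas_e: "i \<ge> 1 \<Longrightarrow> (\<lambda>\<omega>. e i \<omega> $ j) \<in> borel_measurable (F i)"
    and sq_e: "i \<ge> 1 \<Longrightarrow> integrable N (\<lambda>\<omega>. (e i \<omega> $ j)\<^sup>2)"
    and cond_e: "i \<ge> 1 \<Longrightarrow> AE \<omega> in N. real_cond_exp N (F (i - 1)) (\<lambda>\<omega>. e i \<omega> $ j) \<omega> = 0"
    and meas_S: "i \<ge> 1 \<Longrightarrow> (\<lambda>\<omega>. S i \<omega> $ j $ k) \<in> borel_measurable (F (i - 1))"
    and cond_S: "i \<ge> 1 \<Longrightarrow> AE \<omega> in N. S i \<omega> $ j $ k
          = real_cond_exp N (F (i - 1)) (\<lambda>\<omega>. e i \<omega> $ j * e i \<omega> $ k) \<omega>"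
begin

section \<open>Residuals against factors from the past\<close>

lemma space_F: "space (F i) = space N"
  using subalg[of i] by (simp add: subalgebra_def)

lemma sigma_F: "sigma_finite_subalgebra N (F i)"
  by (intro finite_measure_subalgebra_is_sigma_finite finite_measure_subalgebra.intro
      finite_measure_axioms finite_measure_subalgebra_axioms.intro subalg)

lemma lift_F: "f \<in> measurable (F i) L \<Longrightarrow> f \<in> measurable N L"
  by (rule measurable_from_subalg[OF subalg])

lemma lift_F_F: "f \<in> measurable (F i) L \<Longrightarrow> i \<le> k \<Longrightarrow> f \<in> measurable (F k) L"
  using mono[of i k] space_F by (auto simp: measurable_def)

lemma meas_e_N [measurable]: "i \<ge> 1 \<Longrightarrow> (\<lambda>\<omega>. e i \<omega> $ j) \<in> borel_measurable N"
  by (rule lift_F[OF meas_e])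

lemma meas_S_N: "i \<ge> 1 \<Longrightarrow> (\<lambda>\<omega>. S i \<omega> $ j $ k) \<in> borel_measurable N"
  by (rule lift_F[OF meas_S])

lemma integrable_e: "i \<ge> 1 \<Longrightarrow> integrable N (\<lambda>\<omega>. e i \<omega> $ j)"
  using square_integrable_imp_integrable[OF meas_e_N sq_e] by blast

lemma integrable_e_e: "i \<ge> 1 \<Longrightarrow> integrable N (\<lambda>\<omega>. e i \<omega> $ j * e i \<omega> $ k)"
  by (intro integrable_product_of_squares meas_e_N sq_e)

text \<open>Pulling \<open>Z\<close> out of the conditional expectation leaves the conditional mean
  of the residual, which is zero. Only the product has to be integrable: later \<open>Z\<close> is
  an unbounded product of coefficients and residuals, or the derivative of a coefficient.\<close>

lemma integral_past_mult:
  assumes i: "i \<ge> 1" and Z: "Z \<in> borel_measurable (F (i - 1))"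
    and int: "integrable N (\<lambda>\<omega>. Z \<omega> * e i \<omega> $ j)"
  shows "(\<integral>\<omega>. Z \<omega> * e i \<omega> $ j \<partial>N) = 0"
proof -
  interpret sigma_finite_subalgebra N "F (i - 1)" by (rule sigma_F)
  have "(\<integral>\<omega>. Z \<omega> * e i \<omega> $ j \<partial>N) = (\<integral>\<omega>. Z \<omega> * real_cond_exp N (F (i - 1)) (\<lambda>\<omega>. e i \<omega> $ j) \<omega> \<partial>N)"
    using real_cond_exp_intg(2)[OF int Z meas_e_N[OF i]] by simp
  also have "\<dots> = (\<integral>\<omega>. 0 \<partial>N)"
  proof (rule integral_cong_AE)
    show "(\<lambda>\<omega>. Z \<omega> * real_cond_exp N (F (i - 1)) (\<lambda>\<omega>. e i \<omega> $ j) \<omega>) \<in> borel_measurable N"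
      by (intro borel_measurable_times lift_F[OF Z] borel_measurable_cond_exp2)
  qed (use cond_e[OF i, of j] in auto)
  finally show ?thesis by simp
qed

lemma integral_past_mult_mult:
  assumes i: "i \<ge> 1" and Z: "Z \<in> borel_measurable (F (i - 1))"
    and int: "integrable N (\<lambda>\<omega>. Z \<omega> * (e i \<omega> $ j * e i \<omega> $ k))"
  shows "integrable N (\<lambda>\<omega>. Z \<omega> * S i \<omega> $ j $ k)"
    and "(\<integral>\<omega>. Z \<omega> * (e i \<omega> $ j * e i \<omega> $ k) \<partial>N) = (\<integral>\<omega>. Z \<omega> * S i \<omega> $ j $ k \<partial>N)"
proof -
  interpret sigma_finite_subalgebra N "F (i - 1)" by (rule sigma_F)
  let ?R = "real_cond_exp N (F (i - 1)) (\<lambda>\<omega>. e i \<omega> $ j * e i \<omega> $ k)"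
  have ee: "(\<lambda>\<omega>. e i \<omega> $ j * e i \<omega> $ k) \<in> borel_measurable N"
    by (intro borel_measurable_times meas_e_N i)
  have AE: "AE \<omega> in N. Z \<omega> * ?R \<omega> = Z \<omega> * S i \<omega> $ j $ k"
    using cond_S[OF i, of j k] by eventually_elim simp
  have m1: "(\<lambda>\<omega>. Z \<omega> * ?R \<omega>) \<in> borel_measurable N"
    by (intro borel_measurable_times lift_F[OF Z] borel_measurable_cond_exp2)
  have m2: "(\<lambda>\<omega>. Z \<omega> * S i \<omega> $ j $ k) \<in> borel_measurable N"
    by (intro borel_measurable_times lift_F[OF Z] meas_S_N i)
  show "integrable N (\<lambda>\<omega>. Z \<omega> * S i \<omega> $ j $ k)"
    using real_cond_exp_intg(1)[OF int Z ee] integrable_cong_AE[OF m1 m2 AE] by blast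
  show "(\<integral>\<omega>. Z \<omega> * (e i \<omega> $ j * e i \<omega> $ k) \<partial>N) = (\<integral>\<omega>. Z \<omega> * S i \<omega> $ j $ k \<partial>N)"
    using real_cond_exp_intg(2)[OF int Z ee] integral_cong_AE[OF m1 m2 AE] by simp
qed

text \<open>The discrete stochastic integral of \<open>c\<close> against the residuals. Coefficient
  matrices are treated row by row, so each component of an estimating function is a scalar
  transform.\<close>

definition transform :: "nat \<Rightarrow> (nat \<Rightarrow> 'w \<Rightarrow> real^'m) \<Rightarrow> 'w \<Rightarrow> real" where
  "transform n c \<omega> = (\<Sum>i\<in>{1..n}. c i \<omega> \<bullet> e i \<omega>)"

definition predictable :: "nat \<Rightarrow> (nat \<Rightarrow> 'w \<Rightarrow> real^'m) \<Rightarrow> bool" where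
  "predictable n c \<longleftrightarrow> (\<forall>i\<in>{1..n}. \<forall>j. (\<lambda>\<omega>. c i \<omega> $ j) \<in> borel_measurable (F (i - 1)))"

text \<open>This is the case \<open>u = v\<close>, \<open>j = k\<close> of the moment condition in
  \<open>admissible_coeff\<close>. It puts every single term \<open>c * e\<close> into L2, and mixed
  products then follow from \<open>integrable_product_of_squares\<close>.\<close>

definition square_summable :: "nat \<Rightarrow> (nat \<Rightarrow> 'w \<Rightarrow> real^'m) \<Rightarrow> bool" where
  "square_summable n c \<longleftrightarrow> (\<forall>i\<in>{1..n}. \<forall>j. integrable N (\<lambda>\<omega>. c i \<omega> $ j * S i \<omega> $ j $ j * c i \<omega> $ j))"

lemma predictableD:
  "predictable n c \<Longrightarrow> i \<in> {1..n} \<Longrightarrow> (\<lambda>\<omega>. c i \<omega> $ j) \<in> borel_measurable (F (i - 1))"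
  by (simp add: predictable_def)

lemma transform_eq_sum:
  "transform n c \<omega> = (\<Sum>i\<in>{1..n}. \<Sum>j\<in>UNIV. c i \<omega> $ j * e i \<omega> $ j)"
  by (simp add: transform_def inner_vec_def)

lemma meas_transform:
  assumes "predictable n c"
  shows "transform n c \<in> borel_measurable (F n)"
proof -
  have "(\<lambda>\<omega>. c i \<omega> $ j * e i \<omega> $ j) \<in> borel_measurable (F n)" if "i \<in> {1..n}" for i j
    using that by (intro borel_measurable_times lift_F_F[OF predictableD[OF assms that]] lift_F_F[OF meas_e]) auto
  then show ?thesis unfolding transform_eq_sum[abs_def] by (intro borel_measurable_sum) auto
qed

text \<open>Conditioning on the past replaces the squared residual by the diagonal entry of
  \<open>S\<close>, and the outcome is integrable by \<open>square_summable\<close>. The nonnegative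
  form of the argument is essential, as integrability before conditioning is the claim
  itself.\<close>

lemma integrable_term_sq:
  assumes c: "predictable n c" "square_summable n c" and i: "i \<in> {1..n}"
  shows "integrable N (\<lambda>\<omega>. (c i \<omega> $ j * e i \<omega> $ j)\<^sup>2)"
proof -
  interpret sigma_finite_subalgebra N "F (i - 1)" by (rule sigma_F)
  have i1: "i \<ge> 1" using i by simp
  have mc: "(\<lambda>\<omega>. c i \<omega> $ j) \<in> borel_measurable (F (i - 1))" by (rule predictableD[OF c(1) i])
  let ?R = "real_cond_exp N (F (i - 1)) (\<lambda>\<omega>. (e i \<omega> $ j)\<^sup>2)"
  have "integrable N (\<lambda>\<omega>. (c i \<omega> $ j)\<^sup>2 * ?R \<omega>)"
  proof (subst integrable_cong_AE)
    show "integrable N (\<lambda>\<omega>. c i \<omega> $ j * S i \<omega> $ j $ j * c i \<omega> $ j)"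
      using c(2) i by (simp add: square_summable_def)
    show "AE \<omega> in N. (c i \<omega> $ j)\<^sup>2 * ?R \<omega> = c i \<omega> $ j * S i \<omega> $ j $ j * c i \<omega> $ j"
      using cond_S[OF i1, of j j] by eventually_elim (simp add: power2_eq_square)
  qed (use lift_F[OF mc] meas_S_N[OF i1] in measurable)
  then have "integrable N (\<lambda>\<omega>. (c i \<omega> $ j)\<^sup>2 * (e i \<omega> $ j)\<^sup>2)"
    by (intro integrable_mult_of_real_cond_exp[OF _ _ _ sq_e[OF i1]] borel_measurable_power mc zero_le_power2)
  then show ?thesis by (simp add: power_mult_distrib)
qed

lemma meas_term:
  assumes c: "predictable n c" and i: "i \<in> {1..n}"
  shows "(\<lambda>\<omega>. c i \<omega> $ j * e i \<omega> $ j) \<in> borel_measurable N"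
  using i by (intro borel_measurable_times lift_F[OF predictableD[OF c i]] meas_e_N) auto

lemma
  assumes c: "predictable n c" "square_summable n c"
  shows integrable_transform: "integrable N (transform n c)"
    and integral_transform: "(\<integral>\<omega>. transform n c \<omega> \<partial>N) = 0"
proof -
  have int: "integrable N (\<lambda>\<omega>. c i \<omega> $ j * e i \<omega> $ j)" if "i \<in> {1..n}" for i j
    by (rule square_integrable_imp_integrable[OF meas_term[OF c(1) that] integrable_term_sq[OF c that]])
  have zero: "(\<integral>\<omega>. c i \<omega> $ j * e i \<omega> $ j \<partial>N) = 0" if "i \<in> {1..n}" for i j
    using that by (intro integral_past_mult predictableD[OF c(1) that] int) auto
  show "integrable N (transform n c)"
    unfolding transform_eq_sum[abs_def] using int by (intro Bochner_Integration.integrable_sum)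
  show "(\<integral>\<omega>. transform n c \<omega> \<partial>N) = 0"
  proof -
    have "(\<integral>\<omega>. transform n c \<omega> \<partial>N) = (\<Sum>i\<in>{1..n}. \<Sum>j\<in>UNIV. \<integral>\<omega>. c i \<omega> $ j * e i \<omega> $ j \<partial>N)"
      unfolding transform_eq_sum
      by (intro has_bochner_integral_integral_eq has_bochner_integral_sum has_bochner_integral_integrable int)
    also have "\<dots> = 0" using zero by (intro sum.neutral ballI) auto
    finally show ?thesis .
  qed
qed

text \<open>A discrete Ito isometry. The product expands into a double sum over times; at unequal
  times the later residual meets only factors from its past and the mean is zero, while at equal
  times conditioning replaces the product of residuals by \<open>S\<close>.\<close>

lemma
  assumes c: "predictable n c" "square_summable n c" and d: "predictable n d" "square_summable n d"
  shows integrable_transform_mult: "integrable N (\<lambda>\<omega>. transform n c \<omega> * transform n d \<omega>)"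
    and integrable_quadratic: "i \<in> {1..n} \<Longrightarrow> integrable N (\<lambda>\<omega>. c i \<omega> \<bullet> (S i \<omega> *v d i \<omega>))"
    and integral_transform_mult: "(\<integral>\<omega>. transform n c \<omega> * transform n d \<omega> \<partial>N)
      = (\<Sum>i\<in>{1..n}. \<integral>\<omega>. c i \<omega> \<bullet> (S i \<omega> *v d i \<omega>) \<partial>N)"
proof -
  let ?t = "\<lambda>i j k l \<omega>. (c i \<omega> $ j * e i \<omega> $ j) * (d k \<omega> $ l * e k \<omega> $ l)"
  have int: "integrable N (?t i j k l)" if "i \<in> {1..n}" "k \<in> {1..n}" for i j k l
    using that by (intro integrable_product_of_squares meas_term[OF c(1)] meas_term[OF d(1)]
        integrable_term_sq[OF c] integrable_term_sq[OF d])
  have prod: "transform n c \<omega> * transform n d \<omega>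
      = (\<Sum>i\<in>{1..n}. \<Sum>k\<in>{1..n}. \<Sum>j\<in>UNIV. \<Sum>l\<in>UNIV. ?t i j k l \<omega>)" for \<omega>
    unfolding transform_eq_sum by (simp add: sum_product)
  show "integrable N (\<lambda>\<omega>. transform n c \<omega> * transform n d \<omega>)"
    unfolding prod using int by (intro Bochner_Integration.integrable_sum)
  \<comment> \<open>The residual \<open>e i\<close> is known at time \<open>i\<close>, and
    \<open>i < k\<close> gives \<open>i \<le> k - 1\<close>; hence every factor except
    \<open>e k\<close> is known at time \<open>k - 1\<close>.\<close>
  have past: "(\<lambda>\<omega>. c i \<omega> $ j * e i \<omega> $ j * d k \<omega> $ l) \<in> borel_measurable (F (k - 1))"
    if "i \<in> {1..n}" "k \<in> {1..n}" "i < k" for i j k l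
    using that by (intro borel_measurable_times lift_F_F[OF predictableD[OF c(1)]]
        predictableD[OF d(1)] lift_F_F[OF meas_e]) auto
  have past': "(\<lambda>\<omega>. d k \<omega> $ l * e k \<omega> $ l * c i \<omega> $ j) \<in> borel_measurable (F (i - 1))"
    if "i \<in> {1..n}" "k \<in> {1..n}" "k < i" for i j k l
    using that by (intro borel_measurable_times lift_F_F[OF predictableD[OF d(1)]]
        predictableD[OF c(1)] lift_F_F[OF meas_e]) auto
  have off: "(\<integral>\<omega>. ?t i j k l \<omega> \<partial>N) = 0" if ik: "i \<in> {1..n}" "k \<in> {1..n}" "i \<noteq> k" for i j k l
  proof (cases "i < k")
    case True
    show ?thesis
      using integral_past_mult[OF _ past[OF ik(1,2) True, of j l], of l] int[OF ik(1,2), of j l] ik(2)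
      by (simp add: mult.assoc)
  next
    case False
    then have "k < i" using ik by simp
    then show ?thesis
      using integral_past_mult[OF _ past'[OF ik(1,2), of l j], of j] int[OF ik(1,2), of j l] ik(1)
      by (simp add: mult_ac)
  qed
  have cd: "(\<lambda>\<omega>. c i \<omega> $ j * d i \<omega> $ l) \<in> borel_measurable (F (i - 1))" if "i \<in> {1..n}" for i j l
    using that by (intro borel_measurable_times predictableD[OF c(1)] predictableD[OF d(1)])
  have quad: "c i \<omega> \<bullet> (S i \<omega> *v d i \<omega>)
      = (\<Sum>j\<in>UNIV. \<Sum>l\<in>UNIV. c i \<omega> $ j * d i \<omega> $ l * S i \<omega> $ j $ l)" for i \<omega>
    by (simp add: inner_vec_def matrix_vector_mult_def sum_distrib_left mult_ac)
  have diag: "integrable N (\<lambda>\<omega>. c i \<omega> $ j * d i \<omega> $ l * S i \<omega> $ j $ l)"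
    "(\<integral>\<omega>. ?t i j i l \<omega> \<partial>N) = (\<integral>\<omega>. c i \<omega> $ j * d i \<omega> $ l * S i \<omega> $ j $ l \<partial>N)"
    if "i \<in> {1..n}" for i j l
  proof -
    have eq: "?t i j i l \<omega> = c i \<omega> $ j * d i \<omega> $ l * (e i \<omega> $ j * e i \<omega> $ l)" for \<omega>
      by (simp add: mult_ac)
    have i: "i \<ge> 1" using that by simp
    note * = integral_past_mult_mult[OF i cd[OF that, of j l], of j l]
    show "integrable N (\<lambda>\<omega>. c i \<omega> $ j * d i \<omega> $ l * S i \<omega> $ j $ l)"
      "(\<integral>\<omega>. ?t i j i l \<omega> \<partial>N) = (\<integral>\<omega>. c i \<omega> $ j * d i \<omega> $ l * S i \<omega> $ j $ l \<partial>N)"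
      using * int[OF that that, of j l] unfolding eq by blast+
  qed
  show "integrable N (\<lambda>\<omega>. c i \<omega> \<bullet> (S i \<omega> *v d i \<omega>))" if "i \<in> {1..n}"
    unfolding quad using diag(1)[OF that] by (intro Bochner_Integration.integrable_sum)
  have "(\<integral>\<omega>. transform n c \<omega> * transform n d \<omega> \<partial>N)
      = (\<Sum>i\<in>{1..n}. \<Sum>k\<in>{1..n}. \<Sum>j\<in>UNIV. \<Sum>l\<in>UNIV. \<integral>\<omega>. ?t i j k l \<omega> \<partial>N)"
    unfolding prod
    by (intro has_bochner_integral_integral_eq has_bochner_integral_sum has_bochner_integral_integrable int)
  also have "\<dots> = (\<Sum>i\<in>{1..n}. \<Sum>k\<in>{1..n}. if k = i then
      (\<Sum>j\<in>UNIV. \<Sum>l\<in>UNIV. \<integral>\<omega>. c i \<omega> $ j * d i \<omega> $ l * S i \<omega> $ j $ l \<partial>N) else 0)"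
    by (intro sum.cong refl) (auto simp: off diag)
  also have "\<dots> = (\<Sum>i\<in>{1..n}. \<integral>\<omega>. c i \<omega> \<bullet> (S i \<omega> *v d i \<omega>) \<partial>N)"
  proof (intro sum.cong refl)
    fix i assume i: "i \<in> {1..n}"
    have "(\<integral>\<omega>. c i \<omega> \<bullet> (S i \<omega> *v d i \<omega>) \<partial>N)
        = (\<Sum>j\<in>UNIV. \<Sum>l\<in>UNIV. \<integral>\<omega>. c i \<omega> $ j * d i \<omega> $ l * S i \<omega> $ j $ l \<partial>N)"
      unfolding quad
      by (intro has_bochner_integral_integral_eq has_bochner_integral_sum has_bochner_integral_integrable
          diag(1) i)
    then show "(\<Sum>k\<in>{1..n}. if k = i then
        (\<Sum>j\<in>UNIV. \<Sum>l\<in>UNIV. \<integral>\<omega>. c i \<omega> $ j * d i \<omega> $ l * S i \<omega> $ j $ l \<partial>N) else 0)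
        = (\<integral>\<omega>. c i \<omega> \<bullet> (S i \<omega> *v d i \<omega>) \<partial>N)"
      using i by (simp add: sum.delta)
  qed
  finally show "(\<integral>\<omega>. transform n c \<omega> * transform n d \<omega> \<partial>N)
      = (\<Sum>i\<in>{1..n}. \<integral>\<omega>. c i \<omega> \<bullet> (S i \<omega> *v d i \<omega>) \<partial>N)" .
qed

text \<open>
  If the transform vanishes, its last term \<open>d\<^sub>n \<bullet> e\<^sub>n\<close> equals a function of the past; multiplying by
  \<open>e\<^sub>n\<close> and conditioning on the past gives \<open>d\<^sub>n \<Sigma>\<^sub>n = 0\<close>. No integrability of \<open>d\<close> is available, hence
  the truncation to the sets \<open>B\<close>.
\<close>

lemma predictable_last_zero:
  assumes d: "predictable n d" and n: "n \<ge> 1"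
    and zero: "AE \<omega> in N. transform n d \<omega> = 0"
  shows "AE \<omega> in N. d n \<omega> v* S n \<omega> = 0"
proof -
  have nn: "n \<in> {1..n}" using n by simp
  define Z where "Z = transform (n - 1) d"
  have Z: "Z \<in> borel_measurable (F (n - 1))"
    unfolding Z_def by (rule meas_transform) (use d in \<open>auto simp: predictable_def\<close>)
  have md: "(\<lambda>\<omega>. d n \<omega> $ j) \<in> borel_measurable (F (n - 1))" for j by (rule predictableD[OF d nn])
  have split: "transform n d \<omega> = Z \<omega> + (\<Sum>j\<in>UNIV. d n \<omega> $ j * e n \<omega> $ j)" for \<omega>
  proof -
    have "{1..n} = insert n {1..n - 1}" using n by auto
    moreover have "n \<notin> {1..n - 1}" using n by auto
    ultimately show ?thesis by (simp add: transform_def Z_def inner_vec_def)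
  qed
  have "AE \<omega> in N. (d n \<omega> v* S n \<omega>) $ l = 0" for l
  proof -
    define s where "s \<omega> = (\<Sum>j\<in>UNIV. d n \<omega> $ j * S n \<omega> $ j $ l)" for \<omega>
    have ms: "s \<in> borel_measurable (F (n - 1))"
      unfolding s_def by (intro borel_measurable_sum borel_measurable_times md meas_S n)
    have "AE \<omega> in N. \<bar>Z \<omega>\<bar> \<le> real K \<and> (\<forall>j. \<bar>d n \<omega> $ j\<bar> \<le> real K) \<longrightarrow> s \<omega> = 0" for K :: nat
    proof -
      define B where "B = {\<omega> \<in> space (F (n - 1)). \<bar>Z \<omega>\<bar> \<le> real K \<and> (\<forall>j. \<bar>d n \<omega> $ j\<bar> \<le> real K)}"
      have B: "B \<in> sets (F (n - 1))"
        unfolding B_def using Z md by measurable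
      \<comment> \<open>Testing with the sign of \<open>s\<close>, cut off to \<open>B\<close>,
        makes \<open>h * s\<close> equal to the absolute value of \<open>s\<close> on
        \<open>B\<close>. A vanishing integral then forces \<open>s = 0\<close> almost everywhere on
        \<open>B\<close>.\<close>
      define h where "h \<omega> = indicator B \<omega> * sgn (s \<omega>)" for \<omega>
      have mh: "h \<in> borel_measurable (F (n - 1))"
        unfolding h_def using B ms by measurable
      have h1: "\<bar>h \<omega>\<bar> \<le> 1" for \<omega> by (simp add: h_def indicator_def sgn_real_def)
      have hd: "(\<lambda>\<omega>. h \<omega> * d n \<omega> $ j) \<in> borel_measurable (F (n - 1))" for j
        by (intro borel_measurable_times mh md)
      have hZ: "(\<lambda>\<omega>. h \<omega> * Z \<omega>) \<in> borel_measurable (F (n - 1))"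
        by (intro borel_measurable_times mh Z)
      have bd: "\<bar>h \<omega> * d n \<omega> $ j\<bar> \<le> real K" for \<omega> j
        using mult_mono[OF h1[of \<omega>], of "\<bar>d n \<omega> $ j\<bar>" "real K"]
        by (cases "\<omega> \<in> B") (auto simp: B_def h_def abs_mult)
      have bZ: "\<bar>h \<omega> * Z \<omega>\<bar> \<le> real K" for \<omega>
        using mult_mono[OF h1[of \<omega>], of "\<bar>Z \<omega>\<bar>" "real K"]
        by (cases "\<omega> \<in> B") (auto simp: B_def h_def abs_mult)
      have i1: "integrable N (\<lambda>\<omega>. (h \<omega> * d n \<omega> $ j) * (e n \<omega> $ j * e n \<omega> $ l))" for j
        by (rule integrable_bounded_mult[OF lift_F[OF hd] bd integrable_e_e[OF n]])
      have i2: "integrable N (\<lambda>\<omega>. (h \<omega> * Z \<omega>) * e n \<omega> $ l)"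
        by (rule integrable_bounded_mult[OF lift_F[OF hZ] bZ integrable_e[OF n]])
      have "(\<integral>\<omega>. (\<Sum>j\<in>UNIV. (h \<omega> * d n \<omega> $ j) * S n \<omega> $ j $ l) \<partial>N)
          = (\<Sum>j\<in>UNIV. \<integral>\<omega>. (h \<omega> * d n \<omega> $ j) * S n \<omega> $ j $ l \<partial>N)"
        by (intro has_bochner_integral_integral_eq has_bochner_integral_sum has_bochner_integral_integrable
            integral_past_mult_mult(1)[OF n hd i1])
      also have "\<dots> = (\<Sum>j\<in>UNIV. \<integral>\<omega>. (h \<omega> * d n \<omega> $ j) * (e n \<omega> $ j * e n \<omega> $ l) \<partial>N)"
        by (simp only: integral_past_mult_mult(2)[OF n hd i1])
      also have "\<dots> = (\<integral>\<omega>. (\<Sum>j\<in>UNIV. (h \<omega> * d n \<omega> $ j) * (e n \<omega> $ j * e n \<omega> $ l)) \<partial>N)"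
        by (intro has_bochner_integral_integral_eq[symmetric] has_bochner_integral_sum
            has_bochner_integral_integrable i1)
      \<comment> \<open>As the whole transform is zero, its last term is \<open>- Z\<close>; this
        trades an expression quadratic in \<open>e n\<close> for one that is linear in it with a
        factor from the past.\<close>
      also have "\<dots> = (\<integral>\<omega>. - ((h \<omega> * Z \<omega>) * e n \<omega> $ l) \<partial>N)"
      proof (rule integral_cong_AE)
        show "(\<lambda>\<omega>. \<Sum>j\<in>UNIV. (h \<omega> * d n \<omega> $ j) * (e n \<omega> $ j * e n \<omega> $ l)) \<in> borel_measurable N"
          using i1 by (intro borel_measurable_sum borel_measurable_integrable)
        show "(\<lambda>\<omega>. - ((h \<omega> * Z \<omega>) * e n \<omega> $ l)) \<in> borel_measurable N"
          using i2 by (intro borel_measurable_uminus borel_measurable_integrable)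
        show "AE \<omega> in N. (\<Sum>j\<in>UNIV. (h \<omega> * d n \<omega> $ j) * (e n \<omega> $ j * e n \<omega> $ l))
            = - ((h \<omega> * Z \<omega>) * e n \<omega> $ l)"
          using zero
        proof eventually_elim
          fix \<omega> assume "transform n d \<omega> = 0"
          then have eq: "(\<Sum>j\<in>UNIV. d n \<omega> $ j * e n \<omega> $ j) = - Z \<omega>" using split[of \<omega>] by simp
          have "(\<Sum>j\<in>UNIV. (h \<omega> * d n \<omega> $ j) * (e n \<omega> $ j * e n \<omega> $ l))
              = h \<omega> * (\<Sum>j\<in>UNIV. d n \<omega> $ j * e n \<omega> $ j) * e n \<omega> $ l"
            by (simp add: sum_distrib_left sum_distrib_right mult_ac)
          then show "(\<Sum>j\<in>UNIV. (h \<omega> * d n \<omega> $ j) * (e n \<omega> $ j * e n \<omega> $ l))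
              = - ((h \<omega> * Z \<omega>) * e n \<omega> $ l)" by (simp add: eq)
        qed
      qed
      also have "\<dots> = 0" using integral_past_mult[OF n hZ i2] by simp
      finally have int0: "(\<integral>\<omega>. (\<Sum>j\<in>UNIV. (h \<omega> * d n \<omega> $ j) * S n \<omega> $ j $ l) \<partial>N) = 0" .
      have abs: "(\<Sum>j\<in>UNIV. (h \<omega> * d n \<omega> $ j) * S n \<omega> $ j $ l) = indicator B \<omega> * \<bar>s \<omega>\<bar>" for \<omega>
      proof -
        have "(\<Sum>j\<in>UNIV. (h \<omega> * d n \<omega> $ j) * S n \<omega> $ j $ l) = h \<omega> * s \<omega>"
          by (simp add: s_def sum_distrib_left mult_ac)
        then show ?thesis by (simp add: h_def mult_ac abs_sgn)
      qed
      have "integrable N (\<lambda>\<omega>. indicator B \<omega> * \<bar>s \<omega>\<bar>)"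
        unfolding abs[symmetric]
        by (intro Bochner_Integration.integrable_sum integral_past_mult_mult(1)[OF n hd i1])
      then have "AE \<omega> in N. indicator B \<omega> * \<bar>s \<omega>\<bar> = 0"
        using int0 unfolding abs by (subst (asm) integral_nonneg_eq_0_iff_AE) auto
      then show ?thesis
        by (rule AE_mp) (auto intro!: AE_I2 simp: B_def space_F split: split_indicator_asm)
    qed
    \<comment> \<open>The levels \<open>K\<close> are countable, so their null sets can be merged,
      and every point satisfies the bounds for some \<open>K\<close>.\<close>
    then have "AE \<omega> in N. \<forall>K::nat. \<bar>Z \<omega>\<bar> \<le> real K \<and> (\<forall>j. \<bar>d n \<omega> $ j\<bar> \<le> real K) \<longrightarrow> s \<omega> = 0"
      by (subst AE_all_countable) blast
    then show ?thesis
    proof eventually_elim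
      fix \<omega>
      assume K: "\<forall>K::nat. \<bar>Z \<omega>\<bar> \<le> real K \<and> (\<forall>j. \<bar>d n \<omega> $ j\<bar> \<le> real K) \<longrightarrow> s \<omega> = 0"
      obtain K :: nat where "max \<bar>Z \<omega>\<bar> (norm (d n \<omega>)) \<le> real K" using real_arch_simple by blast
      moreover have "\<bar>d n \<omega> $ j\<bar> \<le> norm (d n \<omega>)" for j by (rule component_le_norm_cart)
      ultimately have "s \<omega> = 0" using K by (meson max.bounded_iff order_trans)
      then show "(d n \<omega> v* S n \<omega>) $ l = 0"
        by (simp add: s_def vector_matrix_mult_def mult.commute)
    qed
  qed
  then show ?thesis unfolding vec_eq_iff zero_index
    by (subst AE_all_countable) blast
qed

text \<open>Uniqueness of predictable coefficients, by peeling from the end: an invertible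
  conditional covariance turns \<open>d v* S = 0\<close> into \<open>d = 0\<close> for the last
  coefficient, its term drops out, and the shorter transform vanishes as well.\<close>

lemma transform_eq_0_imp:
  assumes inv: "\<And>i. i \<ge> 1 \<Longrightarrow> AE \<omega> in N. invertible (S i \<omega>)"
  shows "predictable n d \<Longrightarrow> AE \<omega> in N. transform n d \<omega> = 0 \<Longrightarrow> i \<in> {1..n} \<Longrightarrow> AE \<omega> in N. d i \<omega> = 0"
proof (induction n)
  case (Suc n)
  have n1: "Suc n \<ge> 1" by simp
  have last: "AE \<omega> in N. d (Suc n) \<omega> = 0"
    using predictable_last_zero[OF Suc.prems(1) n1 Suc.prems(2)] inv[OF n1]
  proof eventually_elim
    fix \<omega> assume z: "d (Suc n) \<omega> v* S (Suc n) \<omega> = 0" and "invertible (S (Suc n) \<omega>)"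
    then obtain B where "S (Suc n) \<omega> ** B = mat 1" by (auto simp: invertible_def)
    then have "d (Suc n) \<omega> = (d (Suc n) \<omega> v* S (Suc n) \<omega>) v* B"
      by (simp add: vector_matrix_mul_assoc)
    then show "d (Suc n) \<omega> = 0" by (simp add: z)
  qed
  show ?case
  proof (cases "i = Suc n")
    case False
    have "predictable n d" using Suc.prems(1) by (simp add: predictable_def)
    moreover have "AE \<omega> in N. transform n d \<omega> = 0"
      using Suc.prems(2) last by eventually_elim (simp add: transform_def)
    ultimately show ?thesis using False Suc.prems(3) by (intro Suc.IH) auto
  qed (use last in simp)
qed simp

end

section \<open>Matrices\<close>

lemma matrix_inv_inverse:
  fixes A :: "real^'n^'n"
  assumes "invertible A"
  shows "A ** matrix_inv A = mat 1" "matrix_inv A ** A = mat 1"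
proof -
  have "A ** matrix_inv A = mat 1 \<and> matrix_inv A ** A = mat 1"
    using assms unfolding invertible_def matrix_inv_def by (rule someI_ex)
  then show "A ** matrix_inv A = mat 1" "matrix_inv A ** A = mat 1" by simp_all
qed

lemma transpose_matrix_inv:
  fixes A :: "real^'n^'n"
  assumes "invertible A" "transpose A = A"
  shows "transpose (matrix_inv A) = matrix_inv A"
proof -
  have "transpose (matrix_inv A) ** A = mat 1"
    using matrix_inv_inverse(1)[OF assms(1)] assms(2)
    by (metis matrix_transpose_mul transpose_mat)
  then have "transpose (matrix_inv A) ** (A ** matrix_inv A) = matrix_inv A"
    by (simp add: matrix_mul_assoc)
  then show ?thesis by (simp add: matrix_inv_inverse(1)[OF assms(1)])
qed

text \<open>For fixed \<open>a\<close> the form in \<open>pos\<close> is smallest at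
  \<open>b = W^{-1} K a\<close>, and its value there is exactly the quadratic form of the Schur
  complement at \<open>a\<close>.\<close>

lemma nonneg_definite_schur_complement:
  fixes V W K :: "real^'n^'n"
  assumes sym: "transpose V = V" "transpose W = W" and inv: "invertible W"
    and pos: "\<And>a b. 0 \<le> a \<bullet> (V *v a) - 2 * (b \<bullet> (K *v a)) + b \<bullet> (W *v b)"
  shows "nonneg_definite (V - transpose K ** matrix_inv W ** K)"
  unfolding nonneg_definite_def
proof (intro conjI allI)
  show "transpose (V - transpose K ** matrix_inv W ** K) = V - transpose K ** matrix_inv W ** K"
  proof -
    have "transpose (V - L) = transpose V - transpose L" for L
      by (simp add: transpose_def vec_eq_iff)
    then show ?thesis
      by (simp add: sym matrix_transpose_mul transpose_matrix_inv[OF inv sym(2)] matrix_mul_assoc)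
  qed
  fix w
  define b where "b = matrix_inv W *v (K *v w)"
  have Wb: "W *v b = K *v w"
    by (simp add: b_def matrix_vector_mul_assoc matrix_mul_assoc matrix_inv_inverse[OF inv])
  have "w \<bullet> ((transpose K ** matrix_inv W ** K) *v w) = w \<bullet> (transpose K *v b)"
    by (simp add: b_def matrix_vector_mul_assoc matrix_mul_assoc)
  also have "\<dots> = b \<bullet> (K *v w)"
    by (metis dot_lmul_matrix inner_commute transpose_matrix_vector)
  finally show "0 \<le> w \<bullet> ((V - transpose K ** matrix_inv W ** K) *v w)"
    using pos[of w b] by (simp add: matrix_vector_mult_diff_rdistrib inner_diff_right Wb)
qed

lemma diag_mat_mult: "diag_mat a ** diag_mat b = diag_mat (\<chi> j. a $ j * b $ j)"
  by (simp add: diag_mat_def matrix_matrix_mult_def vec_eq_iff mult_delta_left sum.delta)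

lemma diag_mat_1: "diag_mat (\<chi> j. 1) = mat 1"
  by (simp add: diag_mat_def mat_def vec_eq_iff)

section \<open>Estimating functions\<close>

lemma hist_generator_Pow:
  "{y k -` B \<inter> space M | k B. k \<in> {1..i} \<and> B \<in> sets borel} \<subseteq> Pow (space M)"
  by auto

lemma space_hist: "space (hist M y i) = space M"
  unfolding hist_def by (rule space_measure_of[OF hist_generator_Pow])

lemma sets_hist:
  "sets (hist M y i) = sigma_sets (space M) {y k -` B \<inter> space M | k B. k \<in> {1..i} \<and> B \<in> sets borel}"
  unfolding hist_def by (rule sets_measure_of[OF hist_generator_Pow])

lemma sets_hist_mono: "i \<le> l \<Longrightarrow> sets (hist M y i) \<subseteq> sets (hist M y l)"
  unfolding sets_hist by (rule sigma_sets_mono') force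

lemma sets_hist_subset:
  assumes "\<And>k. k \<ge> 1 \<Longrightarrow> y k \<in> measurable M borel"
  shows "sets (hist M y i) \<subseteq> sets M"
  unfolding sets_hist using assms by (intro sets.sigma_sets_subset) (auto intro: measurable_sets)

lemma measurable_hist: "k \<in> {1..i} \<Longrightarrow> y k \<in> measurable (hist M y i) borel"
  by (rule measurableI) (auto simp: space_hist sets_hist)

section \<open>Differentiation in the parameter\<close>

lemma partial_deriv_LIMSEQ:
  fixes f :: "real^'p \<Rightarrow> real"
  assumes "f differentiable (at \<beta>)" and h: "h \<longlonglongrightarrow> 0" "\<And>n. h n \<noteq> 0"
  shows "(\<lambda>n. (f (\<beta> + h n *\<^sub>R axis v 1) - f \<beta>) / h n) \<longlonglongrightarrow> partial_deriv v f \<beta>"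
proof -
  have f: "(f has_derivative frechet_derivative f (at \<beta>)) (at \<beta>)"
    using assms(1) by (simp add: frechet_derivative_works)
  have lin: "linear (frechet_derivative f (at \<beta>))" using f by (rule has_derivative_linear)
  have l: "((\<lambda>t::real. \<beta> + t *\<^sub>R axis v 1) has_derivative (\<lambda>t. t *\<^sub>R axis v 1)) (at 0)"
    by (auto intro!: derivative_eq_intros)
  have "((\<lambda>t. f (\<beta> + t *\<^sub>R axis v 1)) has_derivative (\<lambda>t. frechet_derivative f (at \<beta>) (t *\<^sub>R axis v 1))) (at 0)"
    using has_derivative_compose[OF l, of f "frechet_derivative f (at \<beta>)"] f by simp
  moreover have "(\<lambda>t. frechet_derivative f (at \<beta>) (t *\<^sub>R axis v 1)) = (*) (partial_deriv v f \<beta>)"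
    by (simp add: fun_eq_iff partial_deriv_def linear_cmul[OF lin])
  ultimately have "((\<lambda>t. f (\<beta> + t *\<^sub>R axis v 1)) has_field_derivative partial_deriv v f \<beta>) (at 0)"
    by (simp add: has_field_derivative_def)
  then have "((\<lambda>t. (f (\<beta> + t *\<^sub>R axis v 1) - f \<beta>) / t) \<longlongrightarrow> partial_deriv v f \<beta>) (at 0)"
    by (simp add: DERIV_def)
  moreover have "filterlim h (at 0) sequentially" using h by (simp add: filterlim_at)
  ultimately show ?thesis by (rule filterlim_compose)
qed

text \<open>The derivative is a pointwise limit of difference quotients along one sequence of steps
  common to all \<omega>, so measurability of the values \<open>c b\<close> for \<open>b\<close> in
  \<open>T\<close> carries over. It makes the derivative of a predictable coefficient a legitimate
  past factor.\<close>

lemma partial_deriv_measurable: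
  fixes c :: "real^'p \<Rightarrow> 'w \<Rightarrow> real"
  assumes T: "open T" "\<beta> \<in> T"
    and meas: "\<And>b. b \<in> T \<Longrightarrow> c b \<in> borel_measurable G"
    and diff: "\<And>\<omega>. \<omega> \<in> space G \<Longrightarrow> (\<lambda>b. c b \<omega>) differentiable (at \<beta>)"
  shows "(\<lambda>\<omega>. partial_deriv v (\<lambda>b. c b \<omega>) \<beta>) \<in> borel_measurable G"
proof -
  obtain \<epsilon> where \<epsilon>: "\<epsilon> > 0" "ball \<beta> \<epsilon> \<subseteq> T" using T open_contains_ball by blast
  \<comment> \<open>Starting at \<open>Suc (Suc n)\<close> keeps each step strictly below
    \<epsilon>, so all evaluation points stay in the open ball inside \<open>T\<close>.\<close>
  define h where "h n = \<epsilon> * inverse (real (Suc (Suc n)))" for n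
  have "(\<lambda>n. inverse (real (Suc (Suc n)))) \<longlonglongrightarrow> 0"
    using LIMSEQ_Suc[OF LIMSEQ_inverse_real_of_nat] by simp
  then have h0: "h \<longlonglongrightarrow> 0" unfolding h_def by (rule tendsto_mult_right_zero)
  have hp: "h n \<noteq> 0" "\<bar>h n\<bar> < \<epsilon>" for n
    using \<epsilon>(1) by (auto simp: h_def abs_mult field_simps add_pos_nonneg)
  have mem: "\<beta> + h n *\<^sub>R axis v 1 \<in> T" for n
  proof -
    have "dist \<beta> (\<beta> + h n *\<^sub>R axis v 1) < \<epsilon>" using hp(2) by (simp add: dist_norm norm_axis_1)
    then show ?thesis using \<epsilon>(2) by auto
  qed
  show ?thesis
  proof (rule borel_measurable_LIMSEQ_real)
    show "(\<lambda>n. (c (\<beta> + h n *\<^sub>R axis v 1) \<omega> - c \<beta> \<omega>) / h n)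
        \<longlonglongrightarrow> partial_deriv v (\<lambda>b. c b \<omega>) \<beta>" if "\<omega> \<in> space G" for \<omega>
      by (rule partial_deriv_LIMSEQ[OF diff[OF that] h0 hp(1)])
    show "(\<lambda>\<omega>. (c (\<beta> + h n *\<^sub>R axis v 1) \<omega> - c \<beta> \<omega>) / h n) \<in> borel_measurable G" for n
      using meas[OF mem] meas[OF T(2)] by measurable
  qed
qed

lemma has_derivative_mean_vec:
  fixes Xi :: "real^'p^'m"
  assumes "\<And>t. \<mu> differentiable (at t)"
  shows "((\<lambda>b. mean_vec \<mu> Xi b $ j) has_derivative (\<lambda>h. var_vec \<mu> Xi \<beta> $ j * (Xi $ j \<bullet> h))) (at \<beta>)"
proof -
  have "(\<mu> has_field_derivative deriv \<mu> (Xi $ j \<bullet> \<beta>)) (at (Xi $ j \<bullet> \<beta>))"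
    using assms DERIV_deriv_iff_real_differentiable by blast
  then have "(\<mu> has_derivative (*) (deriv \<mu> (Xi $ j \<bullet> \<beta>))) (at (Xi $ j \<bullet> \<beta>))"
    by (simp add: has_field_derivative_def)
  moreover have "((\<lambda>b. Xi $ j \<bullet> b) has_derivative (\<lambda>h. Xi $ j \<bullet> h)) (at \<beta>)"
    by (auto intro!: derivative_eq_intros)
  ultimately show ?thesis
    using has_derivative_compose[of "\<lambda>b. Xi $ j \<bullet> b" "\<lambda>h. Xi $ j \<bullet> h" \<beta> UNIV \<mu>]
    by (simp add: mean_vec_def var_vec_def)
qed

text \<open>The product rule at a fixed outcome, with \<open>z\<close> the observed responses. The
  two parts are kept apart because their means behave differently: the first multiplies a residual
  by a past factor, the second is linear in the coefficients with non-random weights.\<close>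

lemma jacobian_estimating_function:
  fixes C :: "nat \<Rightarrow> real^'p \<Rightarrow> real^'m^'p" and X :: "nat \<Rightarrow> real^'p^'m"
  assumes T: "open T" "\<beta> \<in> T"
    and \<mu>: "\<And>t. \<mu> differentiable (at t)"
    and C: "\<And>i u j. i \<in> {1..n} \<Longrightarrow> (\<lambda>b. C i b $ u $ j) differentiable (at \<beta>)"
    and q: "\<And>b. b \<in> T \<Longrightarrow> q b = (\<Sum>i\<in>{1..n}. C i b *v (z i - mean_vec \<mu> (X i) b))"
  shows "jacobian q (at \<beta>) $ u $ v = (\<Sum>i\<in>{1..n}. \<Sum>j\<in>UNIV.
      partial_deriv v (\<lambda>b. C i b $ u $ j) \<beta> * (z i $ j - mean_vec \<mu> (X i) \<beta> $ j)
      - C i \<beta> $ u $ j * (var_vec \<mu> (X i) \<beta> $ j * X i $ j $ v))"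
proof -
  define D where "D u h = (\<Sum>i\<in>{1..n}. \<Sum>j\<in>UNIV.
      C i \<beta> $ u $ j * (- (var_vec \<mu> (X i) \<beta> $ j * (X i $ j \<bullet> h)))
      + frechet_derivative (\<lambda>b. C i b $ u $ j) (at \<beta>) h * (z i $ j - mean_vec \<mu> (X i) \<beta> $ j))" for u h
  have "(q has_derivative (\<lambda>h. \<chi> u. D u h)) (at \<beta>)"
  proof (subst has_derivative_componentwise_within, intro ballI)
    fix b :: "real^'p" assume "b \<in> Basis"
    then obtain u where b: "b = axis u 1" by (auto simp: Basis_vec_def)
    have m: "((\<lambda>b. z i $ j - mean_vec \<mu> (X i) b $ j) has_derivative
        (\<lambda>h. - (var_vec \<mu> (X i) \<beta> $ j * (X i $ j \<bullet> h)))) (at \<beta>)" for i j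
      using has_derivative_diff[OF has_derivative_const has_derivative_mean_vec[OF \<mu>]] by simp
    have c: "((\<lambda>b. C i b $ u $ j) has_derivative frechet_derivative (\<lambda>b. C i b $ u $ j) (at \<beta>)) (at \<beta>)"
      if "i \<in> {1..n}" for i j
      using C[OF that] by (simp add: frechet_derivative_works)
    have "((\<lambda>b. \<Sum>i\<in>{1..n}. \<Sum>j\<in>UNIV. C i b $ u $ j * (z i $ j - mean_vec \<mu> (X i) b $ j))
        has_derivative D u) (at \<beta>)"
      unfolding D_def by (intro has_derivative_sum has_derivative_mult c m)
    then have "((\<lambda>b. q b $ u) has_derivative D u) (at \<beta>)"
      \<comment> \<open>The formula for \<open>q\<close> is available on \<open>T\<close> only;
        openness of \<open>T\<close> lets the derivative at \<beta> be read off from it.\<close>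
      by (rule has_derivative_transform_within_open[OF _ T]) (simp add: q matrix_vector_mult_def)
    then show "((\<lambda>x. q x \<bullet> b) has_derivative (\<lambda>h. (\<chi> u. D u h) \<bullet> b)) (at \<beta>)"
      by (simp add: b inner_axis)
  qed
  then have "frechet_derivative q (at \<beta>) = (\<lambda>h. \<chi> u. D u h)"
    by (rule frechet_derivative_at[symmetric])
  then show ?thesis
    by (simp add: jacobian_def matrix_def D_def partial_deriv_def inner_axis algebra_simps)
qed

text \<open>With \<open>Q = A^{1/2}\<close>, \<open>B = A^{-1/2}\<close> and
  \<open>R = B \<Sigma> B\<close>, the factor \<open>R^{-1}\<close> cancels and leaves
  \<open>X^T Q Q = X^T A\<close>: the product with the conditional covariance is no longer random.
  Symmetry of \<Sigma> moves it to the left of a row, the form that occurs in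
  \<open>integral_transform_mult\<close>.\<close>

lemma gbar_coeff_times_cov:
  fixes Xi :: "real^'p^'m"
  assumes pos: "\<And>t. deriv \<mu> t > 0"
    and inv: "invertible (cond_corr \<mu> Xi \<beta> \<Sigma>)" and sym: "transpose \<Sigma> = \<Sigma>"
  shows "\<Sigma> *v ((transpose Xi ** sqrt_A \<mu> Xi \<beta> ** matrix_inv (cond_corr \<mu> Xi \<beta> \<Sigma>)
      ** inv_sqrt_A \<mu> Xi \<beta>) $ v) = (\<chi> j. var_vec \<mu> Xi \<beta> $ j * Xi $ j $ v)"
    and "invertible \<Sigma>"
proof -
  define Q B R where "Q = sqrt_A \<mu> Xi \<beta>" and "B = inv_sqrt_A \<mu> Xi \<beta>" and "R = cond_corr \<mu> Xi \<beta> \<Sigma>"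
  have vpos: "var_vec \<mu> Xi \<beta> $ j > 0" for j by (simp add: var_vec_def pos)
  have BQ: "B ** Q = mat 1"
    using vpos by (simp add: B_def Q_def inv_sqrt_A_def sqrt_A_def diag_mat_mult diag_mat_1[symmetric] less_imp_neq[symmetric])
  have QQ: "Q ** Q = diag_mat (var_vec \<mu> Xi \<beta>)"
    using vpos by (simp add: Q_def sqrt_A_def diag_mat_mult less_imp_le)
  have R: "R = B ** \<Sigma> ** B" by (simp add: R_def B_def cond_corr_def)
  have iR: "matrix_inv R ** R = mat 1" using inv unfolding R_def by (rule matrix_inv_inverse)
  show "invertible \<Sigma>" using inv unfolding R_def[symmetric] R by (simp add: invertible_det_nz det_mul)
  let ?G = "transpose Xi ** Q ** matrix_inv R ** B"
  \<comment> \<open>The identity \<open>B ** Q = mat 1\<close> is inserted to complete the factor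
    \<open>R\<close>; the leftover \<open>Q\<close> then forms the variance matrix with the first
    one.\<close>
  have "?G ** \<Sigma> = transpose Xi ** Q ** matrix_inv R ** (B ** \<Sigma> ** (B ** Q))"
    by (simp add: BQ matrix_mul_assoc)
  also have "\<dots> = transpose Xi ** Q ** (matrix_inv R ** R) ** Q"
    by (simp only: R matrix_mul_assoc)
  also have "\<dots> = transpose Xi ** diag_mat (var_vec \<mu> Xi \<beta>)"
    by (simp add: iR QQ flip: matrix_mul_assoc)
  finally have G\<Sigma>: "?G ** \<Sigma> = transpose Xi ** diag_mat (var_vec \<mu> Xi \<beta>)" .
  have "\<Sigma> *v (?G $ v) = (?G ** \<Sigma>) $ v"
  proof -
    have "\<Sigma> $ j $ k = \<Sigma> $ k $ j" for j k
      using sym by (metis (no_types) transpose_def vec_lambda_beta)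
    then show ?thesis
      by (simp add: vec_eq_iff matrix_vector_mult_def matrix_matrix_mult_def mult.commute)
  qed
  also have "\<dots> = (\<chi> j. var_vec \<mu> Xi \<beta> $ j * Xi $ j $ v)"
    unfolding G\<Sigma>
    by (simp add: vec_eq_iff matrix_matrix_mult_def transpose_def diag_mat_def mult_delta_right sum.delta' mult.commute)
  finally show "\<Sigma> *v ((transpose Xi ** sqrt_A \<mu> Xi \<beta> ** matrix_inv (cond_corr \<mu> Xi \<beta> \<Sigma>)
      ** inv_sqrt_A \<mu> Xi \<beta>) $ v) = (\<chi> j. var_vec \<mu> Xi \<beta> $ j * Xi $ j $ v)"
    by (simp add: Q_def B_def R_def)
qed

lemma borel_measurable_det:
  fixes A :: "'w \<Rightarrow> real^'n^'n"
  assumes "\<And>i j. (\<lambda>\<omega>. A \<omega> $ i $ j) \<in> borel_measurable G"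
  shows "(\<lambda>\<omega>. det (A \<omega>)) \<in> borel_measurable G"
  unfolding det_def using assms by measurable

section \<open>Second moments as quadratic forms\<close>

lemma has_bochner_integral_bilinear:
  fixes f g :: "'w \<Rightarrow> real^'n"
  assumes "\<And>u v. integrable N (\<lambda>\<omega>. f \<omega> $ u * g \<omega> $ v)"
  shows "has_bochner_integral N (\<lambda>\<omega>. (b \<bullet> f \<omega>) * (a \<bullet> g \<omega>))
    (b \<bullet> ((\<chi> u v. \<integral>\<omega>. f \<omega> $ u * g \<omega> $ v \<partial>N) *v a))"
proof -
  have eq: "(b \<bullet> f \<omega>) * (a \<bullet> g \<omega>) = (\<Sum>u\<in>UNIV. \<Sum>v\<in>UNIV. (b $ u * a $ v) * (f \<omega> $ u * g \<omega> $ v))" for \<omega>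
    unfolding inner_vec_def by (simp add: sum_product) (simp add: mult_ac)
  have eq2: "b \<bullet> ((\<chi> u v. \<integral>\<omega>. f \<omega> $ u * g \<omega> $ v \<partial>N) *v a)
      = (\<Sum>u\<in>UNIV. \<Sum>v\<in>UNIV. (b $ u * a $ v) * (\<integral>\<omega>. f \<omega> $ u * g \<omega> $ v \<partial>N))"
    by (simp add: inner_vec_def matrix_vector_mult_def sum_distrib_left mult_ac)
  show ?thesis
    unfolding eq eq2
    by (intro has_bochner_integral_sum has_bochner_integral_mult_right has_bochner_integral_integrable assms)
qed

text \<open>The expression is the mean of the square of
  \<open>a \<bullet> g - b \<bullet> f\<close>. It supplies the hypothesis \<open>pos\<close> of the
  Schur complement lemma.\<close>

lemma second_moment_form_nonneg:
  fixes f g :: "'w \<Rightarrow> real^'n"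
  assumes ff: "\<And>u v. integrable N (\<lambda>\<omega>. f \<omega> $ u * f \<omega> $ v)"
    and fg: "\<And>u v. integrable N (\<lambda>\<omega>. f \<omega> $ u * g \<omega> $ v)"
    and gg: "\<And>u v. integrable N (\<lambda>\<omega>. g \<omega> $ u * g \<omega> $ v)"
  shows "0 \<le> a \<bullet> ((\<chi> u v. \<integral>\<omega>. g \<omega> $ u * g \<omega> $ v \<partial>N) *v a)
    - 2 * (b \<bullet> ((\<chi> u v. \<integral>\<omega>. f \<omega> $ u * g \<omega> $ v \<partial>N) *v a))
    + b \<bullet> ((\<chi> u v. \<integral>\<omega>. f \<omega> $ u * f \<omega> $ v \<partial>N) *v b)" (is "0 \<le> ?r")
proof -
  have "has_bochner_integral N (\<lambda>\<omega>. (a \<bullet> g \<omega>) * (a \<bullet> g \<omega>) - 2 * ((b \<bullet> f \<omega>) * (a \<bullet> g \<omega>))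
      + (b \<bullet> f \<omega>) * (b \<bullet> f \<omega>)) ?r"
    by (intro has_bochner_integral_add has_bochner_integral_diff has_bochner_integral_mult_right
        has_bochner_integral_bilinear assms)
  moreover have "(a \<bullet> g \<omega>) * (a \<bullet> g \<omega>) - 2 * ((b \<bullet> f \<omega>) * (a \<bullet> g \<omega>)) + (b \<bullet> f \<omega>) * (b \<bullet> f \<omega>)
      = (a \<bullet> g \<omega> - b \<bullet> f \<omega>)\<^sup>2" for \<omega>
    by (simp add: power2_eq_square algebra_simps)
  ultimately have "?r = (\<integral>\<omega>. (a \<bullet> g \<omega> - b \<bullet> f \<omega>)\<^sup>2 \<partial>N)"
    by (simp add: has_bochner_integral_integral_eq)
  then show ?thesis by simp
qed

text \<open>Since \<open>is_cond_cov\<close> centres at the model mean \<open>m i\<close>, it speaks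
  about the residuals directly. The zero conditional mean is linearity of conditional expectation,
  with integrability coming from the second moments.\<close>

lemma martingale_differences_residuals:
  fixes y :: "nat \<Rightarrow> 'w \<Rightarrow> real^'m" and m :: "nat \<Rightarrow> real^'m"
  assumes N: "prob_space N" "sets N = sets M"
    and y: "\<And>i. i \<ge> 1 \<Longrightarrow> y i \<in> measurable M borel"
    and sq: "\<And>i j. i \<ge> 1 \<Longrightarrow> integrable N (\<lambda>\<omega>. (y i \<omega> $ j)\<^sup>2)"
    and mean: "\<And>i j. i \<ge> 1 \<Longrightarrow>
      AE \<omega> in N. real_cond_exp N (hist M y (i - 1)) (\<lambda>\<omega>. y i \<omega> $ j) \<omega> = m i $ j"
    and cov: "\<And>i. i \<ge> 1 \<Longrightarrow> is_cond_cov N (hist M y (i - 1)) (y i) (m i) (S i)"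
  shows "martingale_differences N (hist M y) (\<lambda>i \<omega>. y i \<omega> - m i) S"
proof -
  interpret prob_space N by (rule N)
  have spN: "space N = space M" using N(2) by (rule sets_eq_imp_space_eq)
  have sub: "subalgebra N (hist M y i)" for i
    using sets_hist_subset[OF y] by (simp add: subalgebra_def space_hist spN N(2))
  have yh: "(\<lambda>\<omega>. y i \<omega> $ j) \<in> borel_measurable (hist M y i)" if "i \<ge> 1" for i j
    using measurable_compose[OF measurable_hist[of i i y M] borel_measurable_nth] that by simp
  have yN: "(\<lambda>\<omega>. y i \<omega> $ j) \<in> borel_measurable N" if "i \<ge> 1" for i j
    using measurable_from_subalg[OF sub yh[OF that]] .
  have int: "integrable N (\<lambda>\<omega>. y i \<omega> $ j)" if "i \<ge> 1" for i j
    by (rule square_integrable_imp_integrable[OF yN[OF that] sq[OF that]])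
  show ?thesis
  proof (unfold_locales)
    fix i l :: nat and j k :: 'm
    show "subalgebra N (hist M y i)" by (rule sub)
    show "sets (hist M y i) \<subseteq> sets (hist M y l)" if "i \<le> l" by (rule sets_hist_mono[OF that])
    assume i: "i \<ge> 1"
    show "(\<lambda>\<omega>. (y i \<omega> - m i) $ j) \<in> borel_measurable (hist M y i)"
      using yh[OF i] by simp
    show "integrable N (\<lambda>\<omega>. ((y i \<omega> - m i) $ j)\<^sup>2)"
      using sq[OF i, of j] int[OF i, of j] by (simp add: power2_diff)
    show "AE \<omega> in N. real_cond_exp N (hist M y (i - 1)) (\<lambda>\<omega>. (y i \<omega> - m i) $ j) \<omega> = 0"
    proof -
      interpret sigma_finite_subalgebra N "hist M y (i - 1)"
        by (intro finite_measure_subalgebra_is_sigma_finite finite_measure_subalgebra.intro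
            finite_measure_axioms finite_measure_subalgebra_axioms.intro sub)
      have "AE \<omega> in N. real_cond_exp N (hist M y (i - 1)) (\<lambda>\<omega>. m i $ j) \<omega> = m i $ j"
        by (rule real_cond_exp_F_meas) auto
      then show ?thesis
        using mean[OF i, of j]
          real_cond_exp_diff[OF int[OF i, of j] integrable_const[of "m i $ j"]]
        by eventually_elim simp
    qed
    show "(\<lambda>\<omega>. S i \<omega> $ j $ k) \<in> borel_measurable (hist M y (i - 1))"
      and "AE \<omega> in N. S i \<omega> $ j $ k
        = real_cond_exp N (hist M y (i - 1)) (\<lambda>\<omega>. (y i \<omega> - m i) $ j * (y i \<omega> - m i) $ k) \<omega>"
      using cov[OF i] by (simp_all add: is_cond_cov_def)
  qed
qed

section \<open>Estimating functions at a fixed parameter\<close>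

context martingale_differences begin

text \<open>In the mean of the Jacobian all derivatives of coefficients disappear, being past
  factors of residuals; what survives is minus the mean of the coefficients times
  \<open>A X\<close>. The equations in \<open>model\<close> tie the locale data to the statistical
  model.\<close>

lemma est_class_representation:
  fixes \<beta> :: "real^'p"
  assumes model: "N = P \<beta>" "F = hist M y" "e = (\<lambda>i \<omega>. y i \<omega> - mean_vec \<mu> (X i) \<beta>)" "S = (\<lambda>i. Sig i \<beta>)"
    and sets_N: "sets N = sets M"
    and T: "open T" "\<beta> \<in> T" and \<mu>: "\<And>t. \<mu> differentiable (at t)"
    and q: "q \<in> est_class M P T \<mu> X y Sig n"
  obtains C :: "nat \<Rightarrow> 'w \<Rightarrow> real^'m^'p"
    where "\<And>u. predictable n (\<lambda>i \<omega>. C i \<omega> $ u)"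
      and "\<And>u. square_summable n (\<lambda>i \<omega>. C i \<omega> $ u)"
      and "\<And>\<omega> u. \<omega> \<in> space N \<Longrightarrow> q \<beta> \<omega> $ u = transform n (\<lambda>i \<omega>. C i \<omega> $ u) \<omega>"
      and "\<And>i u j. i \<in> {1..n} \<Longrightarrow> integrable N (\<lambda>\<omega>. C i \<omega> $ u $ j)"
      and "\<And>u v. mean_jacobian N q \<beta> $ u $ v
        = - (\<Sum>i\<in>{1..n}. \<integral>\<omega>. C i \<omega> $ u \<bullet> (\<chi> j. var_vec \<mu> (X i) \<beta> $ j * X i $ j $ v) \<partial>N)"
proof -
  obtain C where C: "(\<forall>i\<in>{1..n}. admissible_coeff M P T (hist M y (i - 1)) \<mu> (X i) (y i) (Sig i) (C i)) \<and>
      (\<forall>b\<in>T. \<forall>\<omega>\<in>space M. q b \<omega> = (\<Sum>i\<in>{1..n}. C i b \<omega> *v (y i \<omega> - mean_vec \<mu> (X i) b)))"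
    using q unfolding est_class_def mem_Collect_eq by (rule exE)
  have adm: "admissible_coeff M P T (hist M y (i - 1)) \<mu> (X i) (y i) (Sig i) (C i)"
    if "i \<in> {1..n}" for i using C that by (rule conjunct1[THEN bspec])
  have qC: "q b \<omega> = (\<Sum>i\<in>{1..n}. C i b \<omega> *v (y i \<omega> - mean_vec \<mu> (X i) b))"
    if "b \<in> T" "\<omega> \<in> space M" for b \<omega>
    using C that by blast
  have spN: "space N = space M" using sets_N by (rule sets_eq_imp_space_eq)
  have e_nth: "e i \<omega> $ j = y i \<omega> $ j - mean_vec \<mu> (X i) \<beta> $ j" for i \<omega> j by (simp add: model(3))
  have meas: "(\<lambda>\<omega>. C i b \<omega> $ u $ j) \<in> borel_measurable (F (i - 1))"
    if "i \<in> {1..n}" "b \<in> T" for i b u j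
    using adm[OF that(1)] that(2) unfolding admissible_coeff_def model(2) by blast
  have diff: "(\<lambda>b. C i b \<omega> $ u $ j) differentiable (at \<beta>)" if "i \<in> {1..n}" "\<omega> \<in> space N" for i \<omega> u j
    using adm[OF that(1)] that(2) T(2) unfolding admissible_coeff_def cont_diff_on_def spN by blast
  have int: "integrable N (\<lambda>\<omega>. \<bar>C i \<beta> \<omega> $ u $ j\<bar>)"
    "integrable N (\<lambda>\<omega>. partial_deriv v (\<lambda>b. C i b \<omega> $ u $ j) \<beta> * e i \<omega> $ j)"
    "integrable N (\<lambda>\<omega>. C i \<beta> \<omega> $ u $ j * S i \<omega> $ j $ k * C i \<beta> \<omega> $ v $ k)"
    if "i \<in> {1..n}" for i u v j k
    using adm[OF that] T(2) unfolding admissible_coeff_def model(1,3,4) vector_minus_component by blast+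
  have intC: "integrable N (\<lambda>\<omega>. C i \<beta> \<omega> $ u $ j)" if "i \<in> {1..n}" for i u j
    using int(1)[OF that, of u j] lift_F[OF meas[OF that T(2)]] by (simp add: integrable_abs_iff)
  show ?thesis
  proof (rule that[of "\<lambda>i. C i \<beta>"])
    show "predictable n (\<lambda>i \<omega>. C i \<beta> \<omega> $ u)" for u using meas T(2) by (simp add: predictable_def)
    show "square_summable n (\<lambda>i \<omega>. C i \<beta> \<omega> $ u)" for u using int(3) by (simp add: square_summable_def)
    show "q \<beta> \<omega> $ u = transform n (\<lambda>i \<omega>. C i \<beta> \<omega> $ u) \<omega>" if "\<omega> \<in> space N" for \<omega> u
      using that T(2) by (simp add: qC spN transform_eq_sum e_nth matrix_vector_mult_def)
    show "integrable N (\<lambda>\<omega>. C i \<beta> \<omega> $ u $ j)" if "i \<in> {1..n}" for i u j using intC[OF that] .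
    fix u v
    let ?a = "\<lambda>i j. var_vec \<mu> (X i) \<beta> $ j * X i $ j $ v"
    let ?d = "\<lambda>i j \<omega>. partial_deriv v (\<lambda>b. C i b \<omega> $ u $ j) \<beta>"
    have "mean_jacobian N q \<beta> $ u $ v
        = (\<integral>\<omega>. (\<Sum>i\<in>{1..n}. \<Sum>j\<in>UNIV. ?d i j \<omega> * e i \<omega> $ j - C i \<beta> \<omega> $ u $ j * ?a i j) \<partial>N)"
    proof (simp only: mean_jacobian_def vec_lambda_beta, rule Bochner_Integration.integral_cong[OF refl])
      fix \<omega> assume \<omega>: "\<omega> \<in> space N"
      show "jacobian (\<lambda>b. q b \<omega>) (at \<beta>) $ u $ v
          = (\<Sum>i\<in>{1..n}. \<Sum>j\<in>UNIV. ?d i j \<omega> * e i \<omega> $ j - C i \<beta> \<omega> $ u $ j * ?a i j)"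
        unfolding model(3) vector_minus_component
        by (rule jacobian_estimating_function[OF T \<mu>, where C = "\<lambda>i b. C i b \<omega>" and z = "\<lambda>i. y i \<omega>"])
          (use \<omega> diff qC spN in auto)
    qed
    also have "\<dots> = (\<Sum>i\<in>{1..n}. \<Sum>j\<in>UNIV.
        (\<integral>\<omega>. ?d i j \<omega> * e i \<omega> $ j \<partial>N) - (\<integral>\<omega>. C i \<beta> \<omega> $ u $ j \<partial>N) * ?a i j)"
      by (intro has_bochner_integral_integral_eq has_bochner_integral_sum has_bochner_integral_diff
          has_bochner_integral_mult_left has_bochner_integral_integrable int(2) intC)
    also have "\<dots> = (\<Sum>i\<in>{1..n}. - (\<Sum>j\<in>UNIV. (\<integral>\<omega>. C i \<beta> \<omega> $ u $ j \<partial>N) * ?a i j))"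
    proof (intro sum.cong refl)
      fix i assume i: "i \<in> {1..n}"
      have "(\<integral>\<omega>. ?d i j \<omega> * e i \<omega> $ j \<partial>N) = 0" for j
      proof (rule integral_past_mult[OF _ _ int(2)[OF i]])
        show "?d i j \<in> borel_measurable (F (i - 1))"
          by (rule partial_deriv_measurable[OF T meas[OF i]]) (use diff[OF i] space_F in auto)
      qed (use i in auto)
      then show "(\<Sum>j\<in>UNIV. (\<integral>\<omega>. ?d i j \<omega> * e i \<omega> $ j \<partial>N) - (\<integral>\<omega>. C i \<beta> \<omega> $ u $ j \<partial>N) * ?a i j)
          = - (\<Sum>j\<in>UNIV. (\<integral>\<omega>. C i \<beta> \<omega> $ u $ j \<partial>N) * ?a i j)"
        by (simp add: sum_negf)
    qed
    also have "\<dots> = (\<Sum>i\<in>{1..n}. - (\<integral>\<omega>. C i \<beta> \<omega> $ u \<bullet> (\<chi> j. ?a i j) \<partial>N))"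
    proof (intro sum.cong refl arg_cong[where f = uminus])
      fix i assume i: "i \<in> {1..n}"
      have "(\<integral>\<omega>. C i \<beta> \<omega> $ u \<bullet> (\<chi> j. ?a i j) \<partial>N) = (\<integral>\<omega>. (\<Sum>j\<in>UNIV. C i \<beta> \<omega> $ u $ j * ?a i j) \<partial>N)"
        by (simp add: inner_vec_def)
      also have "\<dots> = (\<Sum>j\<in>UNIV. (\<integral>\<omega>. C i \<beta> \<omega> $ u $ j \<partial>N) * ?a i j)"
        by (intro has_bochner_integral_integral_eq has_bochner_integral_sum
            has_bochner_integral_mult_left has_bochner_integral_integrable intC i)
      finally show "(\<Sum>j\<in>UNIV. (\<integral>\<omega>. C i \<beta> \<omega> $ u $ j \<partial>N) * ?a i j) = (\<integral>\<omega>. C i \<beta> \<omega> $ u \<bullet> (\<chi> j. ?a i j) \<partial>N)" ..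
    qed
    finally show "mean_jacobian N q \<beta> $ u $ v = - (\<Sum>i\<in>{1..n}. \<integral>\<omega>. C i \<beta> \<omega> $ u \<bullet> (\<chi> j. ?a i j) \<partial>N)"
      by (simp add: sum_negf)
  qed
qed

text \<open>The explicit coefficients \<open>G\<close> solve \<open>S G = b\<close>, with
  \<open>b\<close> a column of \<open>A X\<close>. Since \<open>c\<close> represents the same
  component, the transform of the difference vanishes almost surely, and uniqueness hands the
  equation over to \<open>c\<close>.\<close>

lemma gbar_coeff_AE:
  fixes \<beta> :: "real^'p" and X :: "nat \<Rightarrow> real^'p^'m"
  assumes model: "e = (\<lambda>i \<omega>. y i \<omega> - mean_vec \<mu> (X i) \<beta>)" "S = (\<lambda>i. Sig i \<beta>)"
    and pos: "\<And>t. deriv \<mu> t > 0"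
    and inv: "\<And>i. i \<ge> 1 \<Longrightarrow> AE \<omega> in N. invertible (cond_corr \<mu> (X i) \<beta> (S i \<omega>))"
    and c: "predictable n c"
    and rep: "AE \<omega> in N. gbar \<mu> X y Sig n \<beta> \<omega> $ v = transform n c \<omega>"
    and i: "i \<in> {1..n}"
  shows "AE \<omega> in N. S i \<omega> *v c i \<omega> = (\<chi> j. var_vec \<mu> (X i) \<beta> $ j * X i $ j $ v)"
proof -
  define b where "b i = (\<chi> j. var_vec \<mu> (X i) \<beta> $ j * X i $ j $ v)" for i
  define G where "G i \<omega> = (transpose (X i) ** sqrt_A \<mu> (X i) \<beta> ** matrix_inv (cond_corr \<mu> (X i) \<beta> (S i \<omega>))
      ** inv_sqrt_A \<mu> (X i) \<beta>) $ v" for i \<omega>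
  \<comment> \<open>Cramer's rule gives a version of \<open>G\<close> that is visibly measurable with respect to the past.\<close>
  define H where "H i \<omega> = (\<chi> k. det (\<chi> r l. if l = k then b i $ r else S i \<omega> $ r $ l) / det (S i \<omega>))" for i \<omega>
  \<comment> \<open>The entries of \<open>S\<close> are separate versions of conditional
    expectations, hence symmetric only almost surely.\<close>
  have sym: "AE \<omega> in N. transpose (S i \<omega>) = S i \<omega>" if "i \<ge> 1" for i
  proof -
    have "AE \<omega> in N. S i \<omega> $ k $ j = S i \<omega> $ j $ k" for j k
      using cond_S[OF that, of j k] cond_S[OF that, of k j]
      by eventually_elim (simp add: mult.commute)
    then have "AE \<omega> in N. \<forall>j k. S i \<omega> $ k $ j = S i \<omega> $ j $ k"
      by (subst AE_all_countable, intro allI, subst AE_all_countable, blast)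
    then show ?thesis by eventually_elim (simp add: transpose_def vec_eq_iff)
  qed
  \<comment> \<open>Where \<open>S i \<omega>\<close> is singular, \<open>H\<close> is 0 through
    division by 0 whereas \<open>matrix_inv\<close> is an arbitrary choice, so the two are compared
    only almost surely.\<close>
  have key: "AE \<omega> in N. invertible (S i \<omega>) \<and> S i \<omega> *v G i \<omega> = b i \<and> H i \<omega> = G i \<omega>" if "i \<ge> 1" for i
    using inv[OF that] sym[OF that]
  proof eventually_elim
    fix \<omega> assume *: "invertible (cond_corr \<mu> (X i) \<beta> (S i \<omega>))" "transpose (S i \<omega>) = S i \<omega>"
    have 1: "invertible (S i \<omega>)" and 2: "S i \<omega> *v G i \<omega> = b i"
      using gbar_coeff_times_cov[OF pos *] unfolding G_def b_def by blast+
    have "G i \<omega> = H i \<omega>"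
      using 2 cramer[of "S i \<omega>" "G i \<omega>" "b i"] 1 by (simp add: H_def invertible_det_nz)
    with 1 2 show "invertible (S i \<omega>) \<and> S i \<omega> *v G i \<omega> = b i \<and> H i \<omega> = G i \<omega>" by simp
  qed
  have mH: "predictable n H"
    unfolding predictable_def
  proof (intro ballI allI)
    fix i k assume "i \<in> {1..n}"
    then have i1: "i \<ge> 1" by simp
    have "(\<lambda>\<omega>. (\<chi> r l. if l = k then b i $ r else S i \<omega> $ r $ l) $ r $ l) \<in> borel_measurable (F (i - 1))" for r l
      using meas_S[OF i1, of r l] by (cases "l = k") auto
    then show "(\<lambda>\<omega>. H i \<omega> $ k) \<in> borel_measurable (F (i - 1))"
      unfolding H_def vec_lambda_beta
      by (intro borel_measurable_divide borel_measurable_det meas_S i1) auto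
  qed
  have "AE \<omega> in N. \<forall>i\<in>{1..n}. H i \<omega> = G i \<omega>"
  proof (rule AE_finite_allI)
    show "AE \<omega> in N. H i \<omega> = G i \<omega>" if "i \<in> {1..n}" for i
      using key[of i] that by auto
  qed simp
  then have zero: "AE \<omega> in N. transform n (\<lambda>i \<omega>. H i \<omega> - c i \<omega>) \<omega> = 0"
    using rep
  proof eventually_elim
    fix \<omega> assume HG: "\<forall>i\<in>{1..n}. H i \<omega> = G i \<omega>" and g: "gbar \<mu> X y Sig n \<beta> \<omega> $ v = transform n c \<omega>"
    have "gbar \<mu> X y Sig n \<beta> \<omega> $ v = (\<Sum>i\<in>{1..n}. G i \<omega> \<bullet> e i \<omega>)"
      by (simp add: gbar_def G_def model matrix_vector_mul_component)
    also have "\<dots> = transform n H \<omega>" using HG by (simp add: transform_def)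
    finally show "transform n (\<lambda>i \<omega>. H i \<omega> - c i \<omega>) \<omega> = 0"
      using g by (simp add: transform_def inner_diff_left sum_subtractf)
  qed
  have "predictable n (\<lambda>i \<omega>. H i \<omega> - c i \<omega>)"
    using mH c by (simp add: predictable_def borel_measurable_diff)
  then have "AE \<omega> in N. H i \<omega> - c i \<omega> = 0"
    using transform_eq_0_imp[OF _ _ zero i] key by (auto elim: eventually_mono)
  moreover have "AE \<omega> in N. invertible (S i \<omega>) \<and> S i \<omega> *v G i \<omega> = b i \<and> H i \<omega> = G i \<omega>"
    using key i by simp
  ultimately show ?thesis
    unfolding b_def[symmetric] by eventually_elim auto
qed

end

section \<open>Optimality of the quasi-score\<close>

theorem proposition3p6:
  fixes M :: "'w measure"
    and P :: "real^'p \<Rightarrow> 'w measure"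
    and T :: "(real^'p) set"
    and y :: "nat \<Rightarrow> 'w \<Rightarrow> real^'m"
    and X :: "nat \<Rightarrow> real^'p^'m"
    and \<mu> :: "real \<Rightarrow> real"
    and S :: "nat \<Rightarrow> real^'p \<Rightarrow> 'w \<Rightarrow> real^'m^'m"
    and n :: nat
  assumes "open T"
    and "\<And>\<beta>. \<beta> \<in> T \<Longrightarrow> prob_space (P \<beta>) \<and> sets (P \<beta>) = sets M"
    and "\<And>i. i \<ge> 1 \<Longrightarrow> y i \<in> measurable M borel"
    and "\<And>t. \<mu> differentiable (at t) \<and> deriv \<mu> t > 0"
    and "\<And>\<beta> i j. \<beta> \<in> T \<Longrightarrow> i \<ge> 1 \<Longrightarrow> integrable (P \<beta>) (\<lambda>\<omega>. (y i \<omega> $ j)\<^sup>2)"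
    and "\<And>\<beta> i j. \<beta> \<in> T \<Longrightarrow> i \<ge> 1 \<Longrightarrow>
      AE \<omega> in P \<beta>. real_cond_exp (P \<beta>) (hist M y (i - 1)) (\<lambda>\<omega>. y i \<omega> $ j) \<omega> = mean_vec \<mu> (X i) \<beta> $ j"
    and "\<And>\<beta> i j. \<beta> \<in> T \<Longrightarrow> i \<ge> 1 \<Longrightarrow>
      AE \<omega> in P \<beta>. real_cond_var (P \<beta>) (hist M y (i - 1)) (\<lambda>\<omega>. y i \<omega> $ j) \<omega> = var_vec \<mu> (X i) \<beta> $ j"
    and "\<And>\<beta> i. \<beta> \<in> T \<Longrightarrow> i \<ge> 1 \<Longrightarrow>
      is_cond_cov (P \<beta>) (hist M y (i - 1)) (y i) (mean_vec \<mu> (X i) \<beta>) (S i \<beta>)"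
    and "\<And>\<beta> i. \<beta> \<in> T \<Longrightarrow> i \<ge> 1 \<Longrightarrow>
      AE \<omega> in P \<beta>. invertible (cond_corr \<mu> (X i) \<beta> (S i \<beta> \<omega>))"
    and "n \<ge> 1"
    and "gbar \<mu> X y S n \<in> est_class M P T \<mu> X y S n"
  shows "\<forall>q \<in> est_class M P T \<mu> X y S n. \<forall>\<beta>\<in>T.
           invertible (cov_mat (P \<beta>) (gbar \<mu> X y S n \<beta>)) \<longrightarrow>
           invertible (cov_mat (P \<beta>) (q \<beta>)) \<longrightarrow>
           nonneg_definite (info_mat P (gbar \<mu> X y S n) \<beta> - info_mat P q \<beta>)"
proof (intro ballI impI)
  fix q \<beta>
  assume q: "q \<in> est_class M P T \<mu> X y S n" and \<beta>: "\<beta> \<in> T"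
    and inv_g: "invertible (cov_mat (P \<beta>) (gbar \<mu> X y S n \<beta>))"
    and inv_q: "invertible (cov_mat (P \<beta>) (q \<beta>))"
  define N where "N = P \<beta>"
  define g where "g = gbar \<mu> X y S n"
  have N: "prob_space N" "sets N = sets M" using assms(2)[OF \<beta>] by (auto simp: N_def)
  interpret martingale_differences N "hist M y" "\<lambda>i \<omega>. y i \<omega> - mean_vec \<mu> (X i) \<beta>" "\<lambda>i. S i \<beta>"
  proof (rule martingale_differences_residuals[OF N assms(3)])
    fix i :: nat and j assume "i \<ge> 1"
    then show "integrable N (\<lambda>\<omega>. (y i \<omega> $ j)\<^sup>2)"
      and "AE \<omega> in N. real_cond_exp N (hist M y (i - 1)) (\<lambda>\<omega>. y i \<omega> $ j) \<omega> = mean_vec \<mu> (X i) \<beta> $ j"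
      and "is_cond_cov N (hist M y (i - 1)) (y i) (mean_vec \<mu> (X i) \<beta>) (S i \<beta>)"
      unfolding N_def by (rule assms(5,6,8)[OF \<beta>])+
  qed
  note rep = est_class_representation[where P = P and \<beta> = \<beta> and y = y and M = M and T = T and X = X
      and \<mu> = \<mu> and Sig = S, OF N_def refl refl refl N(2) assms(1) \<beta> conjunct1[OF assms(4)]]
  obtain G where G: "\<And>u. predictable n (\<lambda>i \<omega>. G i \<omega> $ u)" "\<And>u. square_summable n (\<lambda>i \<omega>. G i \<omega> $ u)"
    "\<And>\<omega> u. \<omega> \<in> space N \<Longrightarrow> g \<beta> \<omega> $ u = transform n (\<lambda>i \<omega>. G i \<omega> $ u) \<omega>"
    "\<And>i u j. i \<in> {1..n} \<Longrightarrow> integrable N (\<lambda>\<omega>. G i \<omega> $ u $ j)"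
    "\<And>u v. mean_jacobian N g \<beta> $ u $ v
        = - (\<Sum>i\<in>{1..n}. \<integral>\<omega>. G i \<omega> $ u \<bullet> (\<chi> j. var_vec \<mu> (X i) \<beta> $ j * X i $ j $ v) \<partial>N)"
  proof (rule rep[OF assms(11), folded g_def], goal_cases)
    case (1 C)
    show ?case by (rule 1(1)[OF 1(2-)])
  qed
  have opt: "AE \<omega> in N. S i \<beta> \<omega> *v (G i \<omega> $ v) = (\<chi> j. var_vec \<mu> (X i) \<beta> $ j * X i $ j $ v)"
    if "i \<in> {1..n}" for i v
  proof (rule gbar_coeff_AE[where y = y and X = X and \<mu> = \<mu> and \<beta> = \<beta> and Sig = S and n = n
        and c = "\<lambda>i \<omega>. G i \<omega> $ v", OF refl refl conjunct2[OF assms(4)] _ G(1) _ that])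
    show "AE \<omega> in N. invertible (cond_corr \<mu> (X i) \<beta> (S i \<beta> \<omega>))" if "i \<ge> 1" for i
      unfolding N_def by (rule assms(9)[OF \<beta> that])
    show "AE \<omega> in N. gbar \<mu> X y S n \<beta> \<omega> $ v = transform n (\<lambda>i \<omega>. G i \<omega> $ v) \<omega>"
      using G(3) by (intro AE_I2) (simp add: g_def)
  qed
  \<comment> \<open>A general member \<open>f\<close> allows two uses: \<open>f = g\<close>
    identifies the mean Jacobian of the quasi-score with minus its own covariance,
    \<open>f = q\<close> gives minus the cross moments with \<open>g\<close>.\<close>
  have cross: "mean_jacobian N f \<beta> = - (\<chi> u v. \<integral>\<omega>. f \<beta> \<omega> $ u * g \<beta> \<omega> $ v \<partial>N)
      \<and> (\<forall>u v. integrable N (\<lambda>\<omega>. f \<beta> \<omega> $ u * g \<beta> \<omega> $ v))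
      \<and> (\<forall>u v. integrable N (\<lambda>\<omega>. f \<beta> \<omega> $ u * f \<beta> \<omega> $ v))
      \<and> cov_mat N (f \<beta>) = (\<chi> u v. \<integral>\<omega>. f \<beta> \<omega> $ u * f \<beta> \<omega> $ v \<partial>N)"
    if f: "f \<in> est_class M P T \<mu> X y S n" for f
  proof -
    obtain C where C: "\<And>u. predictable n (\<lambda>i \<omega>. C i \<omega> $ u)" "\<And>u. square_summable n (\<lambda>i \<omega>. C i \<omega> $ u)"
      "\<And>\<omega> u. \<omega> \<in> space N \<Longrightarrow> f \<beta> \<omega> $ u = transform n (\<lambda>i \<omega>. C i \<omega> $ u) \<omega>"
      "\<And>i u j. i \<in> {1..n} \<Longrightarrow> integrable N (\<lambda>\<omega>. C i \<omega> $ u $ j)"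
      "\<And>u v. mean_jacobian N f \<beta> $ u $ v
        = - (\<Sum>i\<in>{1..n}. \<integral>\<omega>. C i \<omega> $ u \<bullet> (\<chi> j. var_vec \<mu> (X i) \<beta> $ j * X i $ j $ v) \<partial>N)"
    proof (rule rep[OF f], goal_cases)
      case (1 C)
      show ?case by (rule 1(1)[OF 1(2-)])
    qed
    have int_fg: "integrable N (\<lambda>\<omega>. f \<beta> \<omega> $ u * g \<beta> \<omega> $ v)" for u v
      using integrable_transform_mult[OF C(1,2)[of u] G(1,2)[of v]]
      by (subst Bochner_Integration.integrable_cong[OF refl]) (auto simp: C(3) G(3))
    have int_ff: "integrable N (\<lambda>\<omega>. f \<beta> \<omega> $ u * f \<beta> \<omega> $ v)" for u v
      using integrable_transform_mult[OF C(1,2)[of u] C(1,2)[of v]]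
      by (subst Bochner_Integration.integrable_cong[OF refl]) (auto simp: C(3))
    have "mean_jacobian N f \<beta> $ u $ v = - (\<integral>\<omega>. f \<beta> \<omega> $ u * g \<beta> \<omega> $ v \<partial>N)" for u v
    proof -
      have "(\<integral>\<omega>. f \<beta> \<omega> $ u * g \<beta> \<omega> $ v \<partial>N)
          = (\<integral>\<omega>. transform n (\<lambda>i \<omega>. C i \<omega> $ u) \<omega> * transform n (\<lambda>i \<omega>. G i \<omega> $ v) \<omega> \<partial>N)"
        by (rule Bochner_Integration.integral_cong) (simp_all add: C(3) G(3))
      also have "\<dots> = (\<Sum>i\<in>{1..n}. \<integral>\<omega>. C i \<omega> $ u \<bullet> (S i \<beta> \<omega> *v (G i \<omega> $ v)) \<partial>N)"
        by (rule integral_transform_mult[OF C(1,2) G(1,2)])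
      \<comment> \<open>By \<open>opt\<close> the random vector \<open>S G\<close> is deterministic,
        and the sum becomes the one in the Jacobian formula \<open>C(5)\<close>, up to sign.\<close>
      also have "\<dots> = (\<Sum>i\<in>{1..n}. \<integral>\<omega>. C i \<omega> $ u \<bullet> (\<chi> j. var_vec \<mu> (X i) \<beta> $ j * X i $ j $ v) \<partial>N)"
      proof (intro sum.cong refl integral_cong_AE)
        fix i assume i: "i \<in> {1..n}"
        show "(\<lambda>\<omega>. C i \<omega> $ u \<bullet> (S i \<beta> \<omega> *v (G i \<omega> $ v))) \<in> borel_measurable N"
          using integrable_quadratic[OF C(1,2) G(1,2) i] by (rule borel_measurable_integrable)
        show "(\<lambda>\<omega>. C i \<omega> $ u \<bullet> (\<chi> j. var_vec \<mu> (X i) \<beta> $ j * X i $ j $ v)) \<in> borel_measurable N"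
          using borel_measurable_integrable[OF C(4)[OF i]] by (simp add: inner_vec_def)
        show "AE \<omega> in N. C i \<omega> $ u \<bullet> (S i \<beta> \<omega> *v (G i \<omega> $ v))
            = C i \<omega> $ u \<bullet> (\<chi> j. var_vec \<mu> (X i) \<beta> $ j * X i $ j $ v)"
          using opt[OF i, of v] by eventually_elim simp
      qed
      finally show ?thesis by (simp add: C(5))
    qed
    \<comment> \<open>With mean zero, the covariance matrix is the matrix of raw second
      moments.\<close>
    moreover have "(\<integral>\<omega>. f \<beta> \<omega> $ u \<partial>N) = 0" for u
      using integral_transform[OF C(1,2)[of u]]
      by (subst Bochner_Integration.integral_cong[OF refl C(3)]) auto
    ultimately show ?thesis
      using int_fg int_ff by (simp add: vec_eq_iff cov_mat_def)
  qed
  have sym: "transpose (\<chi> u v. \<integral>\<omega>. f \<omega> $ u * f \<omega> $ v \<partial>N) = (\<chi> u v. \<integral>\<omega>. f \<omega> $ u * f \<omega> $ v \<partial>N)"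
    for f :: "'w \<Rightarrow> real^'p"
    by (simp add: transpose_def mult.commute)
  define K where "K = (\<chi> u v. \<integral>\<omega>. q \<beta> \<omega> $ u * g \<beta> \<omega> $ v \<partial>N)"
  define V where "V = cov_mat N (g \<beta>)"
  define W where "W = cov_mat N (q \<beta>)"
  note cg = cross[OF assms(11), folded g_def] and cq = cross[OF q]
  have Jg: "mean_jacobian N g \<beta> = - V" and Jq: "mean_jacobian N q \<beta> = - K"
    using cg cq by (simp_all add: V_def K_def)
  have symV: "transpose V = V" and symW: "transpose W = W"
    using cg cq sym by (simp_all add: V_def W_def)
  \<comment> \<open>The minus signs of the two Jacobian factors cancel in the information
    matrix.\<close>
  have neg: "transpose (- A) ** B ** (- A) = transpose A ** B ** A" for A B :: "real^'p^'p"
    by (simp add: matrix_matrix_mult_def transpose_def vec_eq_iff sum_negf)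
  have invV: "invertible V" and invW: "invertible W"
    using inv_g inv_q by (simp_all add: V_def W_def N_def g_def)
  \<comment> \<open>By symmetry of \<open>V\<close> the triple product is
    \<open>V V^{-1} V\<close>.\<close>
  have "info_mat P g \<beta> = V"
    by (simp add: info_mat_def Jg neg symV matrix_inv_inverse[OF invV] flip: N_def V_def)
  moreover have "info_mat P q \<beta> = transpose K ** matrix_inv W ** K"
    by (simp add: info_mat_def Jq neg flip: N_def W_def)
  moreover have "nonneg_definite (V - transpose K ** matrix_inv W ** K)"
  proof (rule nonneg_definite_schur_complement[OF symV symW invW])
    fix a b
    show "0 \<le> a \<bullet> (V *v a) - 2 * (b \<bullet> (K *v a)) + b \<bullet> (W *v b)"
      using second_moment_form_nonneg[of N "q \<beta>" "g \<beta>" a b] cg cq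
      by (simp add: V_def W_def K_def)
  qed
  ultimately show "nonneg_definite (info_mat P (gbar \<mu> X y S n) \<beta> - info_mat P q \<beta>)"
    by (simp add: g_def)
qed

end
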